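(* Let $T\in\mathcal{A}_n[\mathbb{C}]$. Then $T\in\mathcal{A}_n(\mathbb{C})$ if and only if $T^*\in\mathcal{A}_n(\mathbb{C})$. Similarly, if $T\in\mathcal{A}_n[\mathbb{R}]$, then $T\in\mathcal{A}_n(\mathbb{R})$ if and only if $T^*\in\mathcal{A}_n(\mathbb{R})$.
   Context: A polynomial $f\in\mathbb{C}[z_1,\ldots,z_n]$ is stable if $f(z_1,\ldots,z_n)\neq 0$ whenever $\operatorname{Im}(z_j)>0$ for all $1\le j\le n$; it is real stable if in addition it has real coefficients. $\mathcal{H}_n(\mathbb{C})$ and $\mathcal{H}_n(\mathbb{R})$ denote the sets of stable and real stable polynomials in $n$ variables. $\mathcal{A}_n[\mathbb{C}]$ is the Weyl algebra of operators $T=\sum_{\alpha,\beta\in\mathbb{N}^n}a_{\alpha\beta}z^\alpha\partial^\beta$ (finite sum, $\partial_i=\partial/\partial z_i$, multi-index notation, $a_{\alpha\beta}\in\mathbb{C}$) acting on $\mathbb{C}[z_1,\ldots,z_n]$, and $\mathcal{A}_n[\mathbb{R}]$ is the subset of those with all $a_{\alpha\beta}\in\mathbb{R}$. $\mathcal{A}_n(\mathbb{C})$ is the set of nonzero $T\in\mathcal{A}_n[\mathbb{C}]$ with $T(\mathcal{H}_n(\mathbb{C}))\subseteq\mathcal{H}_n(\mathbb{C})\cup\{0\}$, and $\mathcal{A}_n(\mathbb{R})$ is the set of nonzero $T\in\mathcal{A}_n[\mathbb{R}]$ with $T(\mathcal{H}_n(\mathbb{R}))\subseteq\mathcal{H}_n(\mathbb{R})\cup\{0\}$.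 The (formal) Fischer-Fock dual of $T=\sum_{\alpha,\beta}a_{\alpha\beta}z^\alpha\partial^\beta$ is $T^*=\sum_{\alpha,\beta}\overline{a_{\beta\alpha}}\,z^\alpha\partial^\beta$. *)

theory Defs
  imports "HOL-Analysis.Analysis" "HOL-Library.Poly_Mapping"
begin

text \<open>Polynomials in variables indexed by a finite type \<open>'n\<close>, so \<open>n = CARD('n)\<close>.
  A multi-index is a value of type \<open>'n \<Rightarrow>\<^sub>0 nat\<close>, and the monomial \<open>z\<^sup>\<alpha>\<close> with
  coefficient \<open>c\<close> is \<open>Poly_Mapping.single \<alpha> c\<close>.\<close>

type_synonym 'n multi_index = "'n \<Rightarrow>\<^sub>0 nat"
type_synonym 'n cpoly = "'n multi_index \<Rightarrow>\<^sub>0 complex"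

definition eval_cpoly :: "'n::finite cpoly \<Rightarrow> ('n \<Rightarrow> complex) \<Rightarrow> complex" where
  "eval_cpoly p z = (\<Sum>\<alpha>\<in>Poly_Mapping.keys p.
      Poly_Mapping.lookup p \<alpha> * (\<Prod>i\<in>UNIV. z i ^ Poly_Mapping.lookup \<alpha> i))"

definition stable_polys :: "'n::finite cpoly set" where
  "stable_polys = {f. \<forall>z. (\<forall>j. Im (z j) > 0) \<longrightarrow> eval_cpoly f z \<noteq> 0}"

definition real_stable_polys :: "'n::finite cpoly set" where
  "real_stable_polys = {f \<in> stable_polys. \<forall>\<alpha>. Poly_Mapping.lookup f \<alpha> \<in> \<real>}"


text \<open>The partial derivative \<open>\<partial>\<^sub>i\<close>, term by term. The truncated subtraction is harmless:
  if \<open>i\<close> does not occur in \<open>\<gamma>\<close>, the coefficient is zero.\<close>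

definition partial_deriv :: "'n::finite \<Rightarrow> 'n cpoly \<Rightarrow> 'n cpoly" where
  "partial_deriv i p = (\<Sum>\<gamma>\<in>Poly_Mapping.keys p.
      Poly_Mapping.single (\<gamma> - Poly_Mapping.single i 1)
        (of_nat (Poly_Mapping.lookup \<gamma> i) * Poly_Mapping.lookup p \<gamma>))"

text \<open>\<open>\<partial>\<^sup>\<beta>\<close> is the composition of the powers \<open>\<partial>\<^sub>i ^^ \<beta>\<^sub>i\<close> over all variables, in
  any order: they commute, see \<open>partial_deriv_power_commute\<close>.\<close>

definition multi_deriv :: "'n::finite multi_index \<Rightarrow> 'n cpoly \<Rightarrow> 'n cpoly" where
  "multi_deriv \<beta> p = Finite_Set.fold (\<lambda>i. partial_deriv i ^^ Poly_Mapping.lookup \<beta> i) p UNIV"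

text \<open>A finitely supported coefficient array \<open>a\<close>, where \<open>a (\<alpha>, \<beta>)\<close> stands for \<open>a\<^sub>\<alpha>\<^sub>\<beta>\<close>,
  determines the operator \<open>\<Sum> a\<^sub>\<alpha>\<^sub>\<beta> z\<^sup>\<alpha> \<partial>\<^sup>\<beta>\<close>.\<close>

type_synonym 'n weyl_coeffs = "('n multi_index \<times> 'n multi_index) \<Rightarrow>\<^sub>0 complex"

definition weyl_op :: "'n::finite weyl_coeffs \<Rightarrow> 'n cpoly \<Rightarrow> 'n cpoly" where
  "weyl_op a p = (\<Sum>(\<alpha>, \<beta>)\<in>Poly_Mapping.keys a.
      Poly_Mapping.single \<alpha> (Poly_Mapping.lookup a (\<alpha>, \<beta>)) * multi_deriv \<beta> p)"

definition weyl_algebra :: "('n::finite cpoly \<Rightarrow> 'n cpoly) set" where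
  "weyl_algebra = {weyl_op a | a. True}"

definition real_weyl_algebra :: "('n::finite cpoly \<Rightarrow> 'n cpoly) set" where
  "real_weyl_algebra = {weyl_op a | a. \<forall>\<alpha> \<beta>. Poly_Mapping.lookup a (\<alpha>, \<beta>) \<in> \<real>}"

definition stability_preservers :: "('n::finite cpoly \<Rightarrow> 'n cpoly) set" where
  "stability_preservers =
    {T \<in> weyl_algebra. T \<noteq> (\<lambda>_. 0) \<and> T ` stable_polys \<subseteq> stable_polys \<union> {0}}"

definition real_stability_preservers :: "('n::finite cpoly \<Rightarrow> 'n cpoly) set" where
  "real_stability_preservers =
    {T \<in> real_weyl_algebra. T \<noteq> (\<lambda>_. 0) \<and>
      T ` real_stable_polys \<subseteq> real_stable_polys \<union> {0}}"

text \<open>The Fischer--Fock dual is defined on operators through their coefficient array, which is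
  unique by \<open>inj_weyl_op\<close> below.\<close>

definition dual_coeffs :: "'n::finite weyl_coeffs \<Rightarrow> 'n weyl_coeffs" where
  "dual_coeffs a = Poly_Mapping.map cnj (Poly_Mapping.map_key prod.swap a)"

definition fischer_fock_dual ::
    "('n::finite cpoly \<Rightarrow> 'n cpoly) \<Rightarrow> 'n cpoly \<Rightarrow> 'n cpoly" where
  "fischer_fock_dual T = weyl_op (dual_coeffs (THE a. weyl_op a = T))"


lemma lookup_partial_deriv:
  "Poly_Mapping.lookup (partial_deriv i p) \<alpha> =
    of_nat (Poly_Mapping.lookup \<alpha> i + 1) * Poly_Mapping.lookup p (\<alpha> + Poly_Mapping.single i 1)"
proof -
  let ?e = "Poly_Mapping.single i (1::nat)"
  have eq: "(of_nat (Poly_Mapping.lookup \<gamma> i) * Poly_Mapping.lookup p \<gamma> when \<gamma> - ?e = \<alpha>)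
      = (if \<gamma> = \<alpha> + ?e then of_nat (Poly_Mapping.lookup \<alpha> i + 1) * Poly_Mapping.lookup p (\<alpha> + ?e)
         else 0)" for \<gamma>
  proof (cases "Poly_Mapping.lookup \<gamma> i = 0")
    case True
    then have "\<gamma> \<noteq> \<alpha> + ?e"
      by (auto simp: lookup_add)
    then show ?thesis using True by simp
  next
    case False
    then have "\<gamma> = (\<gamma> - ?e) + ?e"
      by (intro poly_mapping_eqI) (auto simp: lookup_add lookup_minus lookup_single when_def)
    then have "\<gamma> - ?e = \<alpha> \<longleftrightarrow> \<gamma> = \<alpha> + ?e"
      by (metis add_diff_cancel_right')
    then show ?thesis
      by (auto simp: when_def lookup_add)
  qed
  show ?thesis
    unfolding partial_deriv_def lookup_sum lookup_single eq
    by (auto simp: sum.delta in_keys_iff)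
qed

lemma lookup_partial_deriv_power:
  "Poly_Mapping.lookup ((partial_deriv i ^^ k) p) \<alpha> =
    pochhammer (of_nat (Poly_Mapping.lookup \<alpha> i) + 1) k
      * Poly_Mapping.lookup p (\<alpha> + Poly_Mapping.single i k)"
proof (induction k arbitrary: \<alpha>)
  case 0
  then show ?case by simp
next
  case (Suc k)
  have "\<alpha> + Poly_Mapping.single i 1 + Poly_Mapping.single i k = \<alpha> + Poly_Mapping.single i (Suc k)"
    by (simp add: add.assoc flip: single_add)
  then show ?case
    by (simp add: lookup_partial_deriv Suc.IH lookup_add pochhammer_rec algebra_simps)
qed

lemma partial_deriv_power_commute:
  "(partial_deriv i ^^ k) ((partial_deriv j ^^ l) p) =
    (partial_deriv j ^^ l) ((partial_deriv i ^^ k) p)"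
proof (cases "i = j")
  case True
  then show ?thesis
    by (metis add.commute comp_apply funpow_add)
next
  case False
  then show ?thesis
    by (intro poly_mapping_eqI)
       (simp add: lookup_partial_deriv_power lookup_add lookup_single add.assoc
          add.commute[of "Poly_Mapping.single i k"])
qed

lemma multi_index_sum_single:
  fixes \<beta> :: "'n::finite multi_index"
  shows "(\<Sum>i\<in>UNIV. Poly_Mapping.single i (Poly_Mapping.lookup \<beta> i)) = \<beta>"
  by (intro poly_mapping_eqI) (simp add: lookup_sum lookup_single when_def)

lemma lookup_multi_deriv:
  "Poly_Mapping.lookup (multi_deriv \<beta> p) \<alpha> =
    (\<Prod>i\<in>UNIV. pochhammer (of_nat (Poly_Mapping.lookup \<alpha> i) + 1) (Poly_Mapping.lookup \<beta> i))
      * Poly_Mapping.lookup p (\<alpha> + \<beta>)"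
proof -
  let ?f = "\<lambda>i. partial_deriv i ^^ Poly_Mapping.lookup \<beta> i"
  interpret comp_fun_commute_on UNIV ?f
    by unfold_locales (auto simp: partial_deriv_power_commute)
  have "Poly_Mapping.lookup (Finite_Set.fold ?f p S) \<alpha> =
      (\<Prod>i\<in>S. pochhammer (of_nat (Poly_Mapping.lookup \<alpha> i) + 1) (Poly_Mapping.lookup \<beta> i))
        * Poly_Mapping.lookup p
            (\<alpha> + (\<Sum>i\<in>S. Poly_Mapping.single i (Poly_Mapping.lookup \<beta> i)))" for S
    using finite[of S]
  proof (induction S arbitrary: \<alpha>)
    case empty
    then show ?case by simp
  next
    case (insert j S)
    have "pochhammer (of_nat (Poly_Mapping.lookup
            (\<alpha> + Poly_Mapping.single j (Poly_Mapping.lookup \<beta> j)) i) + 1) (Poly_Mapping.lookup \<beta> i)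
        = pochhammer (of_nat (Poly_Mapping.lookup \<alpha> i) + 1 :: complex) (Poly_Mapping.lookup \<beta> i)"
      if "i \<in> S" for i
      using that insert.hyps by (auto simp: lookup_add lookup_single when_def)
    then show ?case
      using insert by (simp add: lookup_partial_deriv_power add.assoc)
  qed
  then show ?thesis
    by (simp add: multi_deriv_def multi_index_sum_single)
qed

lemma inj_weyl_op: "inj (weyl_op :: 'n::finite weyl_coeffs \<Rightarrow> _)"
proof (rule injI, rule ccontr)
  fix a b :: "'n weyl_coeffs"
  assume eq: "weyl_op a = weyl_op b" and "a \<noteq> b"
  define c where "c = (\<lambda>k. Poly_Mapping.lookup a k - Poly_Mapping.lookup b k)"
  define D where "D = Poly_Mapping.keys a \<union> Poly_Mapping.keys b"
  define deg where "deg = (\<lambda>\<beta>::'n multi_index. \<Sum>i\<in>UNIV. Poly_Mapping.lookup \<beta> i)"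
  have fin: "finite D" by (simp add: D_def)
  obtain k where "c k \<noteq> 0"
    using \<open>a \<noteq> b\<close> poly_mapping_eqI[of a b] by (auto simp: c_def)
  then obtain k0 where k0: "c k0 \<noteq> 0" and "\<forall>k. c k \<noteq> 0 \<longrightarrow> deg (snd k0) \<le> deg (snd k)"
    using ex_has_least_nat[of "\<lambda>k. c k \<noteq> 0" k "\<lambda>k. deg (snd k)"] by blast
  then have least: "deg (snd k0) \<le> deg (snd k)" if "c k \<noteq> 0" for k
    using that by blast
  obtain \<alpha>0 \<beta>0 where k0_eq: "k0 = (\<alpha>0, \<beta>0)" by fastforce
  define m :: "'n cpoly" where "m = Poly_Mapping.single \<beta>0 1"
  define C :: complex where
    "C = (\<Prod>i\<in>UNIV. pochhammer 1 (Poly_Mapping.lookup \<beta>0 i))"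
  have C: "C \<noteq> 0" by (simp add: C_def pochhammer_eq_0_iff flip: pochhammer_fact)
  have k0D: "k0 \<in> D"
    using k0 by (auto simp: c_def D_def in_keys_iff)
  have wD: "weyl_op x m = (\<Sum>k\<in>D. Poly_Mapping.single (fst k) (Poly_Mapping.lookup x k)
      * multi_deriv (snd k) m)" if "Poly_Mapping.keys x \<subseteq> D" for x
    unfolding weyl_op_def using fin that
    by (intro sum.mono_neutral_cong_left) (auto simp: in_keys_iff)
  have term_eq: "Poly_Mapping.single (fst k) (c k) * multi_deriv (snd k) m
      = Poly_Mapping.single (fst k) (if snd k = \<beta>0 then c k * C else 0)" for k
  proof (cases "c k = 0")
    case False
    have deriv: "multi_deriv (snd k) m = Poly_Mapping.single 0 (if snd k = \<beta>0 then C else 0)"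
    proof (rule poly_mapping_eqI)
      fix \<gamma> :: "'n multi_index"
      have "\<gamma> = 0 \<and> snd k = \<beta>0" if g: "\<gamma> + snd k = \<beta>0"
      proof -
        have "deg \<gamma> + deg (snd k) = deg \<beta>0"
          unfolding g[symmetric] by (simp add: deg_def lookup_add sum.distrib)
        then have "deg \<gamma> = 0" using least[OF False] by (simp add: k0_eq)
        then have "\<gamma> = 0" by (intro poly_mapping_eqI) (simp add: deg_def)
        then show ?thesis using g by simp
      qed
      then show "Poly_Mapping.lookup (multi_deriv (snd k) m) \<gamma> =
          Poly_Mapping.lookup (Poly_Mapping.single 0 (if snd k = \<beta>0 then C else 0)) \<gamma>"
        by (auto simp: lookup_multi_deriv m_def lookup_single when_def C_def)
    qed
    show ?thesis by (simp add: deriv mult_single)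
  qed simp
  have "0 = weyl_op a m - weyl_op b m" using eq by simp
  also have "\<dots> = (\<Sum>k\<in>D. Poly_Mapping.single (fst k) (c k) * multi_deriv (snd k) m)"
    by (simp add: wD D_def c_def single_diff left_diff_distrib sum_subtractf)
  also have "\<dots> = (\<Sum>k\<in>D. Poly_Mapping.single (fst k) (if snd k = \<beta>0 then c k * C else 0))"
    by (simp only: term_eq)
  finally have "0 = Poly_Mapping.lookup
      (\<Sum>k\<in>D. Poly_Mapping.single (fst k) (if snd k = \<beta>0 then c k * C else 0)) \<alpha>0"
    by (metis lookup_zero)
  also have "\<dots> = (\<Sum>k\<in>D. if k = k0 then c k0 * C else 0)"
    unfolding lookup_sum by (intro sum.cong) (auto simp: lookup_single when_def k0_eq)
  also have "\<dots> = c k0 * C" using fin k0D by simp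
  finally show False using k0 C by simp
qed

lemma lookup_dual_coeffs:
  "Poly_Mapping.lookup (dual_coeffs a) (\<alpha>, \<beta>) = cnj (Poly_Mapping.lookup a (\<beta>, \<alpha>))"
  by (simp add: dual_coeffs_def map.rep_eq map_key.rep_eq when_def)

lemma fischer_fock_dual_weyl_op: "fischer_fock_dual (weyl_op a) = weyl_op (dual_coeffs a)"
proof -
  have "(THE b. weyl_op b = weyl_op a) = a"
    by (rule the_equality) (auto dest: injD[OF inj_weyl_op])
  then show ?thesis by (simp add: fischer_fock_dual_def)
qed

end

(* Write B(z, w) = F_T(z, -w), where F_T(z, w) = \<Sum> a_{\<alpha>\<beta>} z^\<alpha> w^\<beta> is the symbol of T. Both for complex
   and for real coefficients, T preserves stability if and only if B has no zeros with all z_j and w_j in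
   the open upper half plane. Passing to the dual replaces (z, w) by (-cnj w, -cnj z) and conjugates the
   value, and this preserves the condition.

   If B has no zeros, then T f is the limit of \<Prod>_j (1 - \<partial>_{w_j} \<partial>_{v_j} / N)^N applied to B(z, w) f(v) at
   v = z and w = (i/N, ..., i/N); each factor preserves the absence of zeros, and Hurwitz' theorem
   applies. Conversely, applying T to \<Prod>_i (1 - z_i w_i / N)^N, an approximation of the exponential
   e^(-z.w), and to the product of this with z_j + c shows in the limit that B(z, w) and
   B(z, w) (z_j + c) - \<partial>B/\<partial>w_j are, for fixed w, zero-free or identically zero in z. The second family
   excludes that B vanishes identically in z for a single w. When T is only known to preserve real
   stability, a polynomial f with |f(cnj z)| < |f(z)| is handled through the real stable pencil
   u f + cnj (u f(cnj z)) with |u| = 1. *)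

theory Submission
  imports Defs "HOL-Complex_Analysis.Complex_Analysis"
    "HOL-Computational_Algebra.Fundamental_Theorem_Algebra"
begin

section \<open>Mixed derivatives of zero-free polynomials\<close>

text \<open>Two identities are behind the approximations. Applied to (-w)^\<beta> f(v) and evaluated
  at w = 0, the product over j of exp(-\<partial>_{w_j} \<partial>_{v_j}) gives the \<beta>-th
  derivative of f; conversely T e^(-z.w) = B(z, w) e^(-z.w). Neither is usable as it stands: w = 0
  is a boundary point of the half plane, hence i/N, and the exponential is no polynomial. Both
  limits are therefore written with \<epsilon> = 1/N as expressions polynomial in \<epsilon>, in the
  second case after division by a zero-free power, so that continuity at \<epsilon> = 0 is clear.
  Hurwitz' theorem is applied in z with w fixed, so that a priori the limit may vanish identically
  for some w and not for others. In the real case the pencil treats F(z) and its reflection cnj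
  F(cnj z) alike. To decide for F, one point where F is the larger of the two has to be found;
  e^(-z.w) is larger at z than at cnj z, and this has to survive the operator.\<close>

lemma pderiv_sum: "pderiv (sum f A) = (\<Sum>x\<in>A. pderiv (f x))"
  using higher_pderiv_sum[of 1 f A] by simp

lemma Im_inverse_neg: "Im (inverse z) < 0" if "Im z > 0"
  using that by (auto simp: Im_complex_div_lt_0 inverse_eq_divide complex_is_Real_iff field_simps)

text \<open>The logarithmic derivative is the sum of \<open>1 / (v - \<rho>)\<close> over the roots;
  all have \<open>Im \<rho> \<le> 0\<close>, so each summand lies in the lower half plane. The
  induction splits off one root; without roots the derivative is zero.\<close>

lemma log_deriv_upper:
  fixes p :: "complex poly"
  assumes "\<And>v. Im v > 0 \<Longrightarrow> poly p v \<noteq> 0" and "Im v > 0"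
  shows "pderiv p = 0 \<or> Im (poly (pderiv p) v / poly p v) < 0"
  using assms(1)
proof (induction "degree p" arbitrary: p)
  case 0
  then show ?case by (simp add: pderiv_eq_0_iff)
next
  case (Suc n)
  have "\<not> constant (poly p)"
    using Suc.hyps(2) by (simp add: constant_degree)
  then obtain \<rho> where "poly p \<rho> = 0"
    using Fundamental_Theorem_Algebra.fundamental_theorem_of_algebra by blast
  then obtain q where p: "p = [:-\<rho>, 1:] * q"
    by (auto simp: poly_eq_0_iff_dvd)
  have "q \<noteq> 0" using Suc.hyps(2) p by auto
  then have "degree q = n"
    using Suc.hyps(2) unfolding p by (subst (asm) degree_mult_eq) auto
  have qnz: "poly q u \<noteq> 0" if "Im u > 0" for u
    using Suc.prems[OF that] by (simp add: p)
  have "Im \<rho> \<le> 0"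
    using Suc.prems[of \<rho>] \<open>poly p \<rho> = 0\<close> by force
  then have pos: "Im (v - \<rho>) > 0" using assms(2) by simp
  then have "v \<noteq> \<rho>" by auto
  have dp: "pderiv p = [:-\<rho>, 1:] * pderiv q + q"
    unfolding p pderiv_mult by (simp add: pderiv_pCons)
  have "poly (pderiv p) v = (v - \<rho>) * poly (pderiv q) v + poly q v"
    unfolding dp by (simp add: algebra_simps)
  moreover have "poly p v = (v - \<rho>) * poly q v"
    by (simp add: p algebra_simps)
  ultimately have "poly (pderiv p) v / poly p v = ((v - \<rho>) * poly (pderiv q) v + poly q v) / ((v - \<rho>) * poly q v)"
    by (simp only:)
  also have "\<dots> = inverse (v - \<rho>) + poly (pderiv q) v / poly q v"
    using qnz[OF assms(2)] \<open>v \<noteq> \<rho>\<close> by (simp add: divide_simps)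
  finally have "poly (pderiv p) v / poly p v = inverse (v - \<rho>) + poly (pderiv q) v / poly q v" .
  moreover have "Im (poly (pderiv q) v / poly q v) \<le> 0"
    using Suc.hyps(1)[OF _ qnz] \<open>degree q = n\<close> by fastforce
  ultimately show ?case
    using Im_inverse_neg[OF pos] by simp
qed

lemma log_deriv_upper':
  fixes p :: "complex poly"
  assumes "\<And>v. Im v > 0 \<Longrightarrow> poly p v \<noteq> 0" and "Im v > 0"
  shows "Im (poly (pderiv p) v / poly p v) \<le> 0"
  using log_deriv_upper[OF assms] by auto

text \<open>A zero means \<open>s = - 1 / r\<close> for the logarithmic derivative \<open>r\<close>;
  since \<open>Im r < 0\<close>, this puts \<open>s\<close> into the open lower half plane.\<close>

lemma add_smult_nz:
  fixes p :: "complex poly"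
  assumes "\<And>v. Im v > 0 \<Longrightarrow> poly p v \<noteq> 0" and "Im v > 0" and "Im s \<ge> 0"
  shows "poly p v + s * poly (pderiv p) v \<noteq> 0"
proof
  assume eq: "poly p v + s * poly (pderiv p) v = 0"
  define r where "r = poly (pderiv p) v / poly p v"
  have "poly p v \<noteq> 0" using assms by blast
  then have sr: "s * r = -1"
    using eq by (simp add: r_def field_simps eq_neg_iff_add_eq_0)
  then have "r \<noteq> 0" by auto
  then have "Im r < 0"
    using log_deriv_upper[OF assms(1,2)] by (auto simp: r_def)
  then have "Im (- inverse r) < 0"
    using Im_inverse_neg[of "-r"] by simp
  moreover have "s = - inverse r" using sr \<open>r \<noteq> 0\<close> by (simp add: field_simps)
  ultimately show False using assms(3) by simp
qed

text \<open>For fixed \<open>v\<close> put \<open>P = \<Sum> p\<^sub>k q\<^sub>k(v)\<close> and \<open>Q = \<Sum> p\<^sub>k q\<^sub>k'(v)\<close>. The polynomial \<open>P + s Q\<close> has no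
  zeros in the upper half plane when \<open>Im s \<ge> 0\<close>; letting \<open>s \<rightarrow> \<infinity>\<close> in the resulting inequality for its
  logarithmic derivative shows that \<open>P / Q - \<epsilon> Q' / Q\<close> is not zero.\<close>

lemma mixed_derivative_nz:
  fixes p q :: "'k \<Rightarrow> complex poly"
  assumes nz: "\<And>w v. Im w > 0 \<Longrightarrow> Im v > 0 \<Longrightarrow> (\<Sum>k\<in>K. poly (p k) w * poly (q k) v) \<noteq> 0"
    and w: "Im w > 0" and v: "Im v > 0" and eps: "\<epsilon> \<ge> 0"
  shows "(\<Sum>k\<in>K. poly (p k) w * poly (q k) v
      - of_real \<epsilon> * (poly (pderiv (p k)) w * poly (pderiv (q k)) v)) \<noteq> 0"
proof -
  define P where "P = (\<Sum>k\<in>K. smult (poly (q k) v) (p k))"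
  define Q where "Q = (\<Sum>k\<in>K. smult (poly (pderiv (q k)) v) (p k))"
  have pPu: "poly P u = (\<Sum>k\<in>K. poly (p k) u * poly (q k) v)" for u
    by (simp add: P_def poly_sum mult.commute)
  have R: "poly (P + smult s Q) u \<noteq> 0" if "Im u > 0" "Im s \<ge> 0" for u s
  proof -
    define G where "G = (\<Sum>k\<in>K. smult (poly (p k) u) (q k))"
    have "poly G v + s * poly (pderiv G) v \<noteq> 0"
      by (rule add_smult_nz) (use nz that v in \<open>auto simp: G_def poly_sum\<close>)
    then show ?thesis
      by (simp add: G_def P_def Q_def poly_sum pderiv_sum pderiv_smult mult.commute)
  qed
  let ?P = "poly P w" and ?Q = "poly Q w" and ?P' = "poly (pderiv P) w" and ?Q' = "poly (pderiv Q) w"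
  have P0: "?P \<noteq> 0" using R[OF w, of 0] by simp
  have ld: "Im ((?P' + s * ?Q') / (?P + s * ?Q)) \<le> 0" if "Im s \<ge> 0" for s
    using log_deriv_upper'[of "P + smult s Q" w] R that w by (simp add: pderiv_add pderiv_smult)
  have "?P - of_real \<epsilon> * ?Q' \<noteq> 0"
  proof (cases "?Q = 0")
    case True
    have ld': "Im (?P' / ?P + s * (?Q' / ?P)) \<le> 0" if "Im s \<ge> 0" for s
      using ld[OF that] True by (simp add: add_divide_distrib)
    define c where "c = ?Q' / ?P"
    \<comment> \<open>Replacing \<open>s\<close> by a large positive multiple drowns the fixed term
      \<open>?P' / ?P\<close>, so the inequality holds without it. Then
      \<open>s = 1, -1, \<i>\<close> force \<open>c\<close> to be real and nonpositive.\<close>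
    have c: "Im (s * c) \<le> 0" if "Im s \<ge> 0" for s
    proof (rule ccontr)
      assume "\<not> Im (s * c) \<le> 0"
      then have pos: "Im (s * c) > 0" by simp
      define t where "t = (\<bar>Im (?P' / ?P)\<bar> + 1) / Im (s * c)"
      have "t \<ge> 0" using pos by (simp add: t_def)
      then have "Im (?P' / ?P + (of_real t * s) * c) \<le> 0"
        using ld'[of "of_real t * s"] that by (simp add: c_def)
      moreover have "Im (of_real t * s * c) = t * Im (s * c)"
        by (simp add: mult.assoc)
      moreover have "t * Im (s * c) = \<bar>Im (?P' / ?P)\<bar> + 1"
        using pos by (simp add: t_def)
      ultimately show False by simp
    qed
    have "Im c = 0" using c[of 1] c[of "-1"] by simp
    moreover have "Re c \<le> 0" using c[of \<i>] by simp
    ultimately have c_eq: "c = of_real (Re c)" and "\<epsilon> * Re c \<le> 0"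
      using eps by (simp_all add: complex_eq_iff mult_nonneg_nonpos)
    then have "1 - \<epsilon> * Re c > 0" by linarith
    have "?P - of_real \<epsilon> * ?Q' = ?P * (1 - of_real \<epsilon> * c)"
      using P0 by (simp add: c_def field_simps)
    also have "1 - of_real \<epsilon> * c = complex_of_real (1 - \<epsilon> * Re c)"
      by (subst c_eq) simp
    finally have "?P - of_real \<epsilon> * ?Q' = ?P * of_real (1 - \<epsilon> * Re c)" .
    moreover have "complex_of_real (1 - \<epsilon> * Re c) \<noteq> 0"
      unfolding of_real_eq_0_iff using \<open>1 - \<epsilon> * Re c > 0\<close> by linarith
    ultimately show ?thesis using P0 by (simp only: mult_eq_0_iff simp_thms)
  next
    case False
    have "((\<lambda>x. (?P' * of_real x + \<i> * ?Q') / (?P * of_real x + \<i> * ?Q)) \<longlongrightarrow>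
        (?P' * of_real 0 + \<i> * ?Q') / (?P * of_real 0 + \<i> * ?Q)) (at_right (0::real))"
      by (intro tendsto_intros) (use False in auto)
    then have "((\<lambda>x. Im ((?P' * of_real x + \<i> * ?Q') / (?P * of_real x + \<i> * ?Q))) \<longlongrightarrow> Im (?Q' / ?Q))
        (at_right (0::real))"
      using tendsto_Im by fastforce
    moreover have "Im ((?P' * of_real x + \<i> * ?Q') / (?P * of_real x + \<i> * ?Q)) \<le> 0" if "x > 0" for x :: real
    proof -
      have "(?P' * of_real x + \<i> * ?Q') / (?P * of_real x + \<i> * ?Q) =
          (of_real x * (?P' + (\<i> / of_real x) * ?Q')) / (of_real x * (?P + (\<i> / of_real x) * ?Q))"
        using that by (simp add: algebra_simps)
      also have "\<dots> = (?P' + (\<i> / of_real x) * ?Q') / (?P + (\<i> / of_real x) * ?Q)"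
        using that by simp
      finally show ?thesis using ld[of "\<i> / of_real x"] that by simp
    qed
    then have "\<forall>\<^sub>F x in at_right (0::real).
        Im ((?P' * of_real x + \<i> * ?Q') / (?P * of_real x + \<i> * ?Q)) \<le> 0"
      by (intro eventually_at_rightI[of 0 1]) auto
    ultimately have Q': "Im (?Q' / ?Q) \<le> 0"
      by (rule tendsto_upperbound) simp
    \<comment> \<open>\<open>?Q / ?P\<close> is the logarithmic derivative in \<open>v\<close>;
      \<open>?Q \<noteq> 0\<close> excludes the constant case, so this inequality is strict, while
      the one for \<open>?Q' / ?Q\<close> may be an equality.\<close>
    have "Im (?P / ?Q) > 0"
    proof -
      define G where "G = (\<Sum>k\<in>K. smult (poly (p k) w) (q k))"
      have GP: "poly G v = ?P" and GQ: "poly (pderiv G) v = ?Q"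
        by (simp_all add: G_def P_def Q_def poly_sum pderiv_sum pderiv_smult mult.commute)
      have "pderiv G = 0 \<or> Im (poly (pderiv G) v / poly G v) < 0"
        by (rule log_deriv_upper) (use nz w v in \<open>auto simp: G_def poly_sum\<close>)
      then have "Im (?Q / ?P) < 0" using False GP GQ by auto
      then have "Im (inverse (- (?Q / ?P))) < 0" by (intro Im_inverse_neg) simp
      then show ?thesis by (simp add: field_simps flip: divide_inverse)
    qed
    moreover have "\<epsilon> * Im (?Q' / ?Q) \<le> 0"
      using Q' eps by (simp add: mult_nonneg_nonpos)
    moreover have "Im (of_real \<epsilon> * x) = \<epsilon> * Im x" for x
      by simp
    ultimately have "Im (?P / ?Q - of_real \<epsilon> * (?Q' / ?Q)) > 0"
      by (simp only: minus_complex.sel)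
    moreover have "?P / ?Q - of_real \<epsilon> * (?Q' / ?Q) = (?P - of_real \<epsilon> * ?Q') / ?Q"
      by (simp add: diff_divide_distrib)
    ultimately show ?thesis by auto
  qed
  moreover have "(\<Sum>k\<in>K. poly (p k) w * poly (q k) v
      - of_real \<epsilon> * (poly (pderiv (p k)) w * poly (pderiv (q k)) v)) = ?P - of_real \<epsilon> * ?Q'"
    by (simp add: P_def Q_def poly_sum pderiv_sum pderiv_smult sum_subtractf sum_distrib_left mult_ac)
  ultimately show ?thesis by simp
qed

text \<open>The expanded power is again a sum of products of a polynomial in \<open>w\<close> and
  one in \<open>v\<close>, now indexed by \<open>K \<times> {..N}\<close>, so
  \<open>mixed_derivative_nz\<close> can be iterated; Pascal's rule collects the terms.\<close>

lemma mixed_derivative_power_nz: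
  fixes p q :: "'k \<Rightarrow> complex poly"
  assumes nz: "\<And>w v. Im w > 0 \<Longrightarrow> Im v > 0 \<Longrightarrow> (\<Sum>k\<in>K. poly (p k) w * poly (q k) v) \<noteq> 0"
    and w: "Im w > 0" and v: "Im v > 0" and eps: "\<epsilon> \<ge> 0"
  shows "(\<Sum>k\<in>K. \<Sum>l\<le>N. of_nat (N choose l) * of_real (- \<epsilon>) ^ l
      * (poly ((pderiv ^^ l) (p k)) w * poly ((pderiv ^^ l) (q k)) v)) \<noteq> 0"
  using w v
proof (induction N arbitrary: w v)
  case 0
  then show ?case using nz by simp
next
  case (Suc N)
  define c where "c = (\<lambda>N l. of_nat (N choose l) * complex_of_real (- \<epsilon>) ^ l)"
  define f where "f = (\<lambda>k l. poly ((pderiv ^^ l) (p k)) w * poly ((pderiv ^^ l) (q k)) v)"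
  define p' where "p' = (\<lambda>(k, l). smult (c N l) ((pderiv ^^ l) (p k)))"
  define q' where "q' = (\<lambda>(k::'k, l). (pderiv ^^ l) (q k))"
  have "(\<Sum>x\<in>K \<times> {..N}. poly (p' x) w * poly (q' x) v
      - of_real \<epsilon> * (poly (pderiv (p' x)) w * poly (pderiv (q' x)) v)) \<noteq> 0"
  proof (rule mixed_derivative_nz[OF _ Suc.prems eps])
    fix w v :: complex assume "Im w > 0" "Im v > 0"
    from Suc.IH[OF this] show "(\<Sum>x\<in>K \<times> {..N}. poly (p' x) w * poly (q' x) v) \<noteq> 0"
      by (simp add: p'_def q'_def c_def case_prod_unfold sum.cartesian_product mult.assoc)
  qed
  also have "(\<Sum>x\<in>K \<times> {..N}. poly (p' x) w * poly (q' x) v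
      - of_real \<epsilon> * (poly (pderiv (p' x)) w * poly (pderiv (q' x)) v))
      = (\<Sum>k\<in>K. \<Sum>l\<le>N. c N l * f k l - of_real \<epsilon> * (c N l * f k (Suc l)))"
    by (simp add: p'_def q'_def f_def case_prod_unfold sum.cartesian_product pderiv_smult mult.assoc)
  also have "\<dots> = (\<Sum>k\<in>K. \<Sum>l\<le>Suc N. c (Suc N) l * f k l)"
  proof (rule sum.cong[OF refl])
    fix k
    have "(\<Sum>l\<le>Suc N. c (Suc N) l * f k l) = f k 0 + (\<Sum>l\<le>N. c (Suc N) (Suc l) * f k (Suc l))"
      by (subst sum.atMost_Suc_shift) (simp add: c_def)
    also have "(\<Sum>l\<le>N. c (Suc N) (Suc l) * f k (Suc l)) =
        (\<Sum>l\<le>N. c N (Suc l) * f k (Suc l)) - (\<Sum>l\<le>N. of_real \<epsilon> * (c N l * f k (Suc l)))"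
      unfolding sum_subtractf[symmetric]
      by (intro sum.cong) (simp_all add: c_def algebra_simps)
    also have "f k 0 + ((\<Sum>l\<le>N. c N (Suc l) * f k (Suc l)) - (\<Sum>l\<le>N. of_real \<epsilon> * (c N l * f k (Suc l)))) =
        (\<Sum>l\<le>Suc N. c N l * f k l) - (\<Sum>l\<le>N. of_real \<epsilon> * (c N l * f k (Suc l)))"
      by (subst sum.atMost_Suc_shift) (simp add: c_def)
    finally show "(\<Sum>l\<le>N. c N l * f k l - of_real \<epsilon> * (c N l * f k (Suc l))) =
        (\<Sum>l\<le>Suc N. c (Suc N) l * f k l)"
      by (simp add: c_def sum_subtractf)
  qed
  finally show ?case by (simp add: c_def f_def)
qed

section \<open>Hurwitz' theorem on products of half planes\<close>

definition upper :: "('n \<Rightarrow> complex) set" where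
  "upper = {z. \<forall>i. Im (z i) > 0}"

lemma upperI: "(\<And>i. Im (z i) > 0) \<Longrightarrow> z \<in> upper"
  by (simp add: upper_def)

lemma upperD: "z \<in> upper \<Longrightarrow> Im (z i) > 0"
  by (simp add: upper_def)

text \<open>A zero and a nonzero of the limit are joined by a complex line, whose part in
  \<open>upper\<close> is open and convex; there Hurwitz' theorem in one variable applies. Hence the
  hypotheses ask for regularity along lines only.\<close>

lemma hurwitz_upper:
  fixes g :: "('n::finite \<Rightarrow> complex) \<Rightarrow> real \<Rightarrow> complex"
  assumes cont: "\<And>z0 z1. continuous_on UNIV (\<lambda>x. g (\<lambda>i. z0 i + snd x * (z1 i - z0 i)) (fst x))"
    and hol: "\<And>z0 z1 \<epsilon>. (\<lambda>t. g (\<lambda>i. z0 i + t * (z1 i - z0 i)) \<epsilon>) holomorphic_on UNIV"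
    and e: "e \<longlonglongrightarrow> 0"
    and ev: "\<forall>\<^sub>F k in sequentially. (\<forall>z\<in>upper. g z (e k) \<noteq> 0) \<or> (\<forall>z\<in>upper. g z (e k) = 0)"
  shows "(\<forall>z\<in>upper. g z 0 \<noteq> 0) \<or> (\<forall>z\<in>upper. g z 0 = 0)"
proof (rule ccontr)
  assume "\<not> ?thesis"
  then obtain z0 z1 where z: "z0 \<in> upper" "z1 \<in> upper" "g z0 0 = 0" "g z1 0 \<noteq> 0"
    by blast
  define L where "L = (\<lambda>t i. z0 i + t * (z1 i - z0 i))"
  define G where "G = (\<lambda>x. g (L (snd x)) (fst x))"
  have L01: "L 0 = z0" "L 1 = z1" by (auto simp: L_def)
  have contG: "continuous_on UNIV G"
    using cont[of z0 z1] by (simp add: G_def L_def)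
  have contG': "continuous_on A (\<lambda>x. G (f x))" if "continuous_on A f" for A :: "'c::topological_space set" and f
    using continuous_on_compose2[OF contG that] by simp
  define S where "S = {t. L t \<in> upper}"
  \<comment> \<open>Each coordinate contributes one open half plane of parameters \<open>t\<close>,
    written with an inner product.\<close>
  have S_eq: "S = (\<Inter>i. {t. inner (Complex (Im (z1 i - z0 i)) (Re (z1 i - z0 i))) t > - Im (z0 i)})"
    by (auto simp: S_def upper_def L_def inner_complex_def algebra_simps)
  have "open S" unfolding S_eq by (intro open_INT) (auto simp: open_halfspace_gt)
  have "convex S" unfolding S_eq by (intro convex_INT) (auto simp: convex_halfspace_gt)
  have S01: "0 \<in> S" "1 \<in> S" using z by (auto simp: S_def L01)
  have "(\<lambda>k. G (e k, 1)) \<longlonglongrightarrow> G (0, 1)"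
    using contG e by (intro isCont_tendsto_compose[of _ G] tendsto_intros)
      (auto simp: continuous_on_eq_continuous_at)
  then have "\<forall>\<^sub>F k in sequentially. G (e k, 1) \<noteq> 0"
    using z(4) by (intro tendsto_imp_eventually_ne) (auto simp: G_def L01)
  with ev have "\<forall>\<^sub>F k in sequentially. \<forall>z\<in>upper. g z (e k) \<noteq> 0"
    by eventually_elim (use z(2) in \<open>auto simp: G_def L01\<close>)
  then obtain k0 where k0: "g z (e k) \<noteq> 0" if "k \<ge> k0" "z \<in> upper" for k z
    by (auto simp: eventually_sequentially)
  have "G (0, 0) \<noteq> 0"
  proof (rule Hurwitz_no_zeros[of S "\<lambda>n t. G (e (n + k0), t)" "\<lambda>t. G (0, t)" 0])
    show "open S" "connected S" "0 \<in> S"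
      using \<open>open S\<close> \<open>convex S\<close> S01 by (auto intro: convex_connected)
    show "(\<lambda>t. G (e (n + k0), t)) holomorphic_on S" for n
      using hol[of z0 z1 "e (n + k0)"] by (auto simp: G_def L_def intro: holomorphic_on_subset)
    show "(\<lambda>t. G (0, t)) holomorphic_on S"
      using hol[of z0 z1 0] by (auto simp: G_def L_def intro: holomorphic_on_subset)
    show "uniform_limit K (\<lambda>n t. G (e (n + k0), t)) (\<lambda>t. G (0, t)) sequentially"
      if K: "compact K" "K \<subseteq> S" for K
    proof (rule uniform_limitI)
      fix d :: real assume "d > 0"
      obtain X where X: "0 \<in> X" "open X" "\<forall>x\<in>X \<inter> UNIV. \<forall>t\<in>K. dist (G (x, t)) (G (0, t)) \<le> d / 2"
        using continuous_on_prod_compactE[of UNIV K G 0 "d / 2"] contG K(1) \<open>d > 0\<close>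
        by (metis UNIV_I continuous_on_subset half_gt_zero subset_UNIV)
      have "\<forall>\<^sub>F n in sequentially. e (n + k0) \<in> X"
        using LIMSEQ_ignore_initial_segment[OF e, of k0] X(1,2) by (intro topological_tendstoD)
      then show "\<forall>\<^sub>F n in sequentially. \<forall>t\<in>K. dist (G (e (n + k0), t)) (G (0, t)) < d"
      proof eventually_elim
        case (elim n)
        then have "dist (G (e (n + k0), t)) (G (0, t)) \<le> d / 2" if "t \<in> K" for t
          using X(3) that by blast
        then show ?case using \<open>d > 0\<close> by (smt (verit) field_sum_of_halves)
      qed
    qed
    show "\<not> (\<lambda>t. G (0, t)) constant_on S"
    proof
      assume "(\<lambda>t. G (0, t)) constant_on S"
      then have "G (0, 0) = G (0, 1)" using S01 by (auto simp: constant_on_def)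
      then show False using z by (simp add: G_def L01)
    qed
    show "G (e (n + k0), t) \<noteq> 0" if "t \<in> S" for n t
      using k0[of "n + k0" "L t"] that by (auto simp: G_def S_def)
  qed
  then show False using z(3) by (simp add: G_def L01)
qed

section \<open>Evaluation of polynomials and operators\<close>

definition mval :: "'n::finite multi_index \<Rightarrow> ('n \<Rightarrow> complex) \<Rightarrow> complex" where
  "mval \<alpha> z = (\<Prod>i\<in>UNIV. z i ^ Poly_Mapping.lookup \<alpha> i)"

lemma mval_add: "mval (\<alpha> + \<beta>) z = mval \<alpha> z * mval \<beta> z"
  by (simp add: mval_def lookup_add power_add prod.distrib)

lemma eval_cpoly_superset:
  assumes "finite S" "Poly_Mapping.keys p \<subseteq> S"
  shows "eval_cpoly p z = (\<Sum>\<alpha>\<in>S. Poly_Mapping.lookup p \<alpha> * mval \<alpha> z)"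
  unfolding eval_cpoly_def mval_def using assms
  by (intro sum.mono_neutral_left) (auto simp: in_keys_iff)

lemma eval_cpoly_add: "eval_cpoly (p + q) z = eval_cpoly p z + eval_cpoly q z"
proof -
  let ?S = "Poly_Mapping.keys p \<union> Poly_Mapping.keys q"
  have "eval_cpoly r z = (\<Sum>\<alpha>\<in>?S. Poly_Mapping.lookup r \<alpha> * mval \<alpha> z)"
    if "r \<in> {p, q, p + q}" for r
    using that keys_add[of p q] by (intro eval_cpoly_superset) auto
  then show ?thesis
    by (simp add: lookup_add algebra_simps sum.distrib)
qed

lemma eval_cpoly_0 [simp]: "eval_cpoly 0 z = 0"
  by (simp add: eval_cpoly_def)

lemma eval_cpoly_sum: "eval_cpoly (sum f A) z = (\<Sum>x\<in>A. eval_cpoly (f x) z)"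
  by (induction A rule: infinite_finite_induct) (simp_all add: eval_cpoly_add)

lemma eval_cpoly_single: "eval_cpoly (Poly_Mapping.single \<alpha> c) z = c * mval \<alpha> z"
  using eval_cpoly_superset[of "{\<alpha>}" "Poly_Mapping.single \<alpha> c" z] by simp

lemma cpoly_sum_single:
  fixes p :: "'n::finite cpoly"
  shows "p = (\<Sum>\<alpha>\<in>Poly_Mapping.keys p. Poly_Mapping.single \<alpha> (Poly_Mapping.lookup p \<alpha>))"
  by (intro poly_mapping_eqI) (auto simp: lookup_sum lookup_single when_def in_keys_iff)

lemma eval_cpoly_single_mult:
  "eval_cpoly (Poly_Mapping.single \<alpha> c * p) z = c * mval \<alpha> z * eval_cpoly p z"
proof -
  have "Poly_Mapping.single \<alpha> c * p = (\<Sum>\<gamma>\<in>Poly_Mapping.keys p.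
      Poly_Mapping.single (\<alpha> + \<gamma>) (c * Poly_Mapping.lookup p \<gamma>))"
    by (subst cpoly_sum_single[of p]) (simp add: sum_distrib_left mult_single)
  then show ?thesis
    by (simp add: eval_cpoly_sum eval_cpoly_single mval_add eval_cpoly_superset[OF finite_keys order.refl, of p]
        sum_distrib_left mult_ac)
qed

text \<open>Freezing all variables but one gives a univariate polynomial with infinitely many roots,
  hence with zero coefficients; each coefficient is a sum over indices \<open>K'\<close> that agree
  in this variable. The sets \<open>S i\<close> may vary, so that z and -w can lie in opposite half
  planes.\<close>

lemma sum_monomials_eq_0_imp:
  fixes c :: "'k \<Rightarrow> complex" and d :: "'k \<Rightarrow> 'i \<Rightarrow> nat"
  assumes "finite I" "finite K"
    and "\<And>k l. k \<in> K \<Longrightarrow> l \<in> K \<Longrightarrow> (\<And>i. i \<in> I \<Longrightarrow> d k i = d l i) \<Longrightarrow> k = l"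
    and "\<And>i. i \<in> I \<Longrightarrow> infinite (S i)"
    and "\<And>z. (\<And>i. i \<in> I \<Longrightarrow> z i \<in> S i) \<Longrightarrow> (\<Sum>k\<in>K. c k * (\<Prod>i\<in>I. z i ^ d k i)) = 0"
    and "k \<in> K"
  shows "c k = 0"
  using assms
proof (induction I arbitrary: K k rule: finite_induct)
  case empty
  then have "K = {k}" by auto
  then show ?case using empty.prems(4) by simp
next
  case (insert j I)
  define K' where "K' = {l \<in> K. d l j = d k j}"
  show ?case
  proof (rule insert.IH[of K' k])
    show "finite K'" "k \<in> K'" using insert.prems by (auto simp: K'_def)
    show "infinite (S i)" if "i \<in> I" for i using insert.prems that by auto
    show "l = l'" if "l \<in> K'" "l' \<in> K'" "\<And>i. i \<in> I \<Longrightarrow> d l i = d l' i" for l l'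
      using that by (intro insert.prems(2)) (auto simp: K'_def)
    fix z :: "'i \<Rightarrow> complex" assume z: "\<And>i. i \<in> I \<Longrightarrow> z i \<in> S i"
    define p where "p = (\<Sum>l\<in>K. monom (c l * (\<Prod>i\<in>I. z i ^ d l i)) (d l j))"
    have "poly p x = 0" if "x \<in> S j" for x
    proof -
      have "(\<Prod>i\<in>I. (z(j := x)) i ^ m i) = (\<Prod>i\<in>I. z i ^ m i)" for m
        using insert.hyps by (intro prod.cong) auto
      moreover have "(z(j := x)) i \<in> S i" if "i \<in> insert j I" for i
        using that z \<open>x \<in> S j\<close> by auto
      ultimately show ?thesis
        using insert.prems(4)[of "z(j := x)"] insert.hyps
        by (simp add: p_def poly_sum poly_monom mult_ac del: fun_upd_apply)
           (simp add: mult_ac)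
    qed
    then have "S j \<subseteq> {x. poly p x = 0}" by blast
    then have "infinite {x. poly p x = 0}"
      using insert.prems(3)[of j] finite_subset by auto
    then have "p = 0" using poly_roots_finite by blast
    then have "coeff p (d k j) = 0" by simp
    also have "coeff p (d k j) = (\<Sum>l\<in>K. if d l j = d k j then c l * (\<Prod>i\<in>I. z i ^ d l i) else 0)"
      by (auto simp: p_def coeff_sum intro!: sum.cong)
    also have "\<dots> = (\<Sum>l\<in>K'. c l * (\<Prod>i\<in>I. z i ^ d l i))"
      unfolding K'_def using insert.prems(1) by (simp add: sum.inter_filter)
    finally show "(\<Sum>l\<in>K'. c l * (\<Prod>i\<in>I. z i ^ d l i)) = 0" .
  qed
qed

text \<open>Monomials and test polynomials are both of this shape, on which partial derivatives act
  factor by factor.\<close>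

definition tensor_cpoly :: "('n::finite \<Rightarrow> complex poly) \<Rightarrow> 'n cpoly" where
  "tensor_cpoly p = Abs_poly_mapping (\<lambda>\<gamma>. \<Prod>i\<in>UNIV. coeff (p i) (Poly_Mapping.lookup \<gamma> i))"

lemma bij_lookup_multi_index: "bij (Poly_Mapping.lookup :: 'n::finite multi_index \<Rightarrow> _)"
proof (rule bijI')
  show "Poly_Mapping.lookup x = Poly_Mapping.lookup y \<longleftrightarrow> x = y" for x y :: "'n multi_index"
    by (simp add: lookup_inject)
  show "\<exists>x. y = Poly_Mapping.lookup x" for y :: "'n \<Rightarrow> nat"
    by (intro exI[of _ "Abs_poly_mapping y"]) simp
qed

lemma finite_bounded_multi_index:
  fixes m :: "'n::finite \<Rightarrow> nat"
  shows "finite {\<gamma>. \<forall>i. Poly_Mapping.lookup \<gamma> i \<le> m i}"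
proof (rule finite_imageD[of Poly_Mapping.lookup])
  have "Poly_Mapping.lookup ` {\<gamma>. \<forall>i. Poly_Mapping.lookup \<gamma> i \<le> m i} \<subseteq> (\<Pi>\<^sub>E i\<in>UNIV. {..m i})"
    by auto
  then show "finite (Poly_Mapping.lookup ` {\<gamma>. \<forall>i. Poly_Mapping.lookup \<gamma> i \<le> m i})"
    by (rule finite_subset) (intro finite_PiE, auto)
  show "inj_on Poly_Mapping.lookup {\<gamma>. \<forall>i. Poly_Mapping.lookup \<gamma> i \<le> m i}"
    using bij_lookup_multi_index bij_is_inj inj_on_subset by blast
qed

lemma lookup_tensor_cpoly:
  "Poly_Mapping.lookup (tensor_cpoly p) \<gamma> = (\<Prod>i\<in>UNIV. coeff (p i) (Poly_Mapping.lookup \<gamma> i))"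
proof -
  have "{\<gamma>. (\<Prod>i\<in>UNIV. coeff (p i) (Poly_Mapping.lookup \<gamma> i)) \<noteq> 0}
      \<subseteq> {\<gamma>. \<forall>i. Poly_Mapping.lookup \<gamma> i \<le> degree (p i)}"
    by (auto intro: le_degree)
  then have "finite {\<gamma>. (\<Prod>i\<in>UNIV. coeff (p i) (Poly_Mapping.lookup \<gamma> i)) \<noteq> 0}"
    by (rule finite_subset) (rule finite_bounded_multi_index)
  then show ?thesis by (simp add: tensor_cpoly_def)
qed

lemma eval_tensor_cpoly:
  fixes p :: "'n::finite \<Rightarrow> complex poly"
  shows "eval_cpoly (tensor_cpoly p) z = (\<Prod>i\<in>UNIV. poly (p i) (z i))"
proof -
  let ?B = "{\<gamma>. \<forall>i. Poly_Mapping.lookup \<gamma> i \<le> degree (p i)}"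
  have "Poly_Mapping.keys (tensor_cpoly p) \<subseteq> ?B"
    by (auto simp: in_keys_iff lookup_tensor_cpoly intro: le_degree)
  then have "eval_cpoly (tensor_cpoly p) z =
      (\<Sum>\<gamma>\<in>?B. \<Prod>i\<in>UNIV. coeff (p i) (Poly_Mapping.lookup \<gamma> i) * z i ^ Poly_Mapping.lookup \<gamma> i)"
    by (subst eval_cpoly_superset[OF finite_bounded_multi_index])
       (auto simp: lookup_tensor_cpoly mval_def prod.distrib)
  also have "\<dots> = (\<Sum>g\<in>(\<Pi>\<^sub>E i\<in>UNIV. {..degree (p i)}). \<Prod>i\<in>UNIV. coeff (p i) (g i) * z i ^ g i)"
  proof (rule sum.reindex_bij_betw[of Poly_Mapping.lookup ?B _
      "\<lambda>g. \<Prod>i\<in>UNIV. coeff (p i) (g i) * z i ^ g i"])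
    have "Poly_Mapping.lookup ` ?B = (\<Pi>\<^sub>E i\<in>UNIV. {..degree (p i)})"
    proof (intro equalityI subsetI)
      fix g assume "g \<in> (\<Pi>\<^sub>E i\<in>UNIV. {..degree (p i)})"
      then have "Abs_poly_mapping g \<in> ?B" "g = Poly_Mapping.lookup (Abs_poly_mapping g)"
        by (auto simp: PiE_iff)
      then show "g \<in> Poly_Mapping.lookup ` ?B" by blast
    qed auto
    then show "bij_betw Poly_Mapping.lookup ?B (\<Pi>\<^sub>E i\<in>UNIV. {..degree (p i)})"
      unfolding bij_betw_def
      using inj_on_subset[OF bij_is_inj[OF bij_lookup_multi_index] subset_UNIV] by simp
  qed
  also have "\<dots> = (\<Prod>i\<in>UNIV. poly (p i) (z i))"
    by (simp add: poly_altdef prod_sum_PiE)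
  finally show ?thesis .
qed

lemma multi_deriv_tensor_cpoly:
  "multi_deriv \<beta> (tensor_cpoly p) = tensor_cpoly (\<lambda>i. (pderiv ^^ Poly_Mapping.lookup \<beta> i) (p i))"
  by (intro poly_mapping_eqI)
     (simp add: lookup_multi_deriv lookup_tensor_cpoly coeff_higher_pderiv lookup_add
        prod.distrib add.commute)

lemma single_eq_tensor_cpoly:
  fixes \<gamma> :: "'n::finite multi_index"
  shows "Poly_Mapping.single \<gamma> 1 = tensor_cpoly (\<lambda>i. monom 1 (Poly_Mapping.lookup \<gamma> i))"
proof (rule poly_mapping_eqI)
  fix \<alpha> :: "'n multi_index"
  show "Poly_Mapping.lookup (Poly_Mapping.single \<gamma> 1) \<alpha> =
      Poly_Mapping.lookup (tensor_cpoly (\<lambda>i. monom (1::complex) (Poly_Mapping.lookup \<gamma> i))) \<alpha>"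
  proof (cases "\<gamma> = \<alpha>")
    case False
    then obtain i where "Poly_Mapping.lookup \<gamma> i \<noteq> Poly_Mapping.lookup \<alpha> i"
      using poly_mapping_eqI[of \<gamma> \<alpha>] by auto
    then show ?thesis using False by (auto simp: lookup_tensor_cpoly lookup_single)
  qed (simp add: lookup_tensor_cpoly)
qed

lemma lookup_single_0_mult:
  "Poly_Mapping.lookup (Poly_Mapping.single 0 c * q) \<alpha> = c * Poly_Mapping.lookup q \<alpha>"
  for q :: "'n::finite cpoly"
proof -
  have "Poly_Mapping.single 0 c * q = (\<Sum>\<gamma>\<in>Poly_Mapping.keys q.
      Poly_Mapping.single \<gamma> (c * Poly_Mapping.lookup q \<gamma>))"
    by (subst cpoly_sum_single[of q]) (simp add: sum_distrib_left mult_single)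
  then show ?thesis
    by (auto simp: lookup_sum lookup_single when_def in_keys_iff)
qed

lemma eval_multi_deriv:
  "eval_cpoly (multi_deriv \<beta> f) z = (\<Sum>\<gamma>\<in>Poly_Mapping.keys f. Poly_Mapping.lookup f \<gamma> *
    (\<Prod>i\<in>UNIV. poly ((pderiv ^^ Poly_Mapping.lookup \<beta> i) (monom 1 (Poly_Mapping.lookup \<gamma> i))) (z i)))"
proof -
  have deriv: "multi_deriv \<beta> f = (\<Sum>\<gamma>\<in>Poly_Mapping.keys f.
      Poly_Mapping.single 0 (Poly_Mapping.lookup f \<gamma>) * multi_deriv \<beta> (Poly_Mapping.single \<gamma> 1))"
    (is "_ = ?R")
  proof (rule poly_mapping_eqI)
    fix \<alpha>
    have "Poly_Mapping.lookup ?R \<alpha> = (\<Sum>\<gamma>\<in>Poly_Mapping.keys f. if \<gamma> = \<alpha> + \<beta> then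
        (\<Prod>i\<in>UNIV. pochhammer (of_nat (Poly_Mapping.lookup \<alpha> i) + 1) (Poly_Mapping.lookup \<beta> i))
          * Poly_Mapping.lookup f (\<alpha> + \<beta>) else 0)"
      unfolding lookup_sum
      by (intro sum.cong refl) (auto simp: lookup_single_0_mult lookup_multi_deriv lookup_single when_def)
    also have "\<dots> = Poly_Mapping.lookup (multi_deriv \<beta> f) \<alpha>"
      by (auto simp: lookup_multi_deriv in_keys_iff)
    finally show "Poly_Mapping.lookup (multi_deriv \<beta> f) \<alpha> = Poly_Mapping.lookup ?R \<alpha>" ..
  qed
  show ?thesis
    by (subst deriv) (simp add: eval_cpoly_sum eval_cpoly_single_mult mval_def single_eq_tensor_cpoly
        multi_deriv_tensor_cpoly eval_tensor_cpoly)
qed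

lemma eval_weyl_op:
  "eval_cpoly (weyl_op a f) z = (\<Sum>k\<in>Poly_Mapping.keys a.
    Poly_Mapping.lookup a k * mval (fst k) z * eval_cpoly (multi_deriv (snd k) f) z)"
  by (simp add: weyl_op_def eval_cpoly_sum eval_cpoly_single_mult case_prod_unfold)

lemma eval_weyl_op_tensor:
  "eval_cpoly (weyl_op a (tensor_cpoly p)) z = (\<Sum>k\<in>Poly_Mapping.keys a.
    Poly_Mapping.lookup a k * mval (fst k) z *
    (\<Prod>i\<in>UNIV. poly ((pderiv ^^ Poly_Mapping.lookup (snd k) i) (p i)) (z i)))"
  by (simp add: eval_weyl_op multi_deriv_tensor_cpoly eval_tensor_cpoly)

section \<open>Operators with zero-free symbol\<close>

text \<open>This is B: the sign of \<open>w\<close> is built in, so that the condition concerns both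
  arguments in \<open>upper\<close>.\<close>

definition symbol :: "'n::finite weyl_coeffs \<Rightarrow> ('n \<Rightarrow> complex) \<Rightarrow> ('n \<Rightarrow> complex) \<Rightarrow> complex" where
  "symbol a z w = (\<Sum>k\<in>Poly_Mapping.keys a.
    Poly_Mapping.lookup a k * mval (fst k) z * mval (snd k) (\<lambda>i. - w i))"

text \<open>The value at \<open>(w, v)\<close> of \<open>(1 - \<epsilon> \<partial>\<^sub>w \<partial>\<^sub>v)\<^sup>N\<close> applied to \<open>p(w) q(v)\<close>.\<close>

definition mixed_power :: "nat \<Rightarrow> real \<Rightarrow> complex poly \<Rightarrow> complex poly \<Rightarrow> complex \<Rightarrow> complex \<Rightarrow> complex" where
  "mixed_power N \<epsilon> p q w v = (\<Sum>l\<le>N. of_nat (N choose l) * of_real (- \<epsilon>) ^ l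
      * (poly ((pderiv ^^ l) p) w * poly ((pderiv ^^ l) q) v))"

text \<open>The coordinates are treated one after another: \<open>S\<close> holds those where the
  power has been applied. For the next one, all factors in other coordinates are constants,
  collected in \<open>A\<close>.\<close>

lemma mixed_power_coordinates_nz:
  fixes p q :: "'k \<Rightarrow> 'n::finite \<Rightarrow> complex poly"
  assumes eps: "\<epsilon> \<ge> 0"
    and nz: "\<And>w v. w \<in> upper \<Longrightarrow> v \<in> upper \<Longrightarrow>
      (\<Sum>k\<in>K. c k * (\<Prod>i\<in>UNIV. poly (p k i) (w i) * poly (q k i) (v i))) \<noteq> 0"
    and wv: "w \<in> upper" "v \<in> upper"
  shows "(\<Sum>k\<in>K. c k * (\<Prod>i\<in>UNIV. mixed_power N \<epsilon> (p k i) (q k i) (w i) (v i))) \<noteq> 0"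
proof -
  define P where "P = (\<lambda>k i w v. poly (p k i) (w i) * poly (q k i) (v i))"
  define M where "M = (\<lambda>k i w v. mixed_power N \<epsilon> (p k i) (q k i) (w i) (v i))"
  have "(\<Sum>k\<in>K. c k * ((\<Prod>i\<in>S. M k i w v) * (\<Prod>i\<in>-S. P k i w v))) \<noteq> 0" for S
    using finite[of S] wv
  proof (induction S arbitrary: w v)
    case empty
    then show ?case using nz by (simp add: P_def)
  next
    case (insert j S)
    define A where "A = (\<lambda>k. c k * ((\<Prod>i\<in>S. M k i w v) * (\<Prod>i\<in>-insert j S. P k i w v)))"
    have "(\<Sum>k\<in>K. \<Sum>l\<le>N. of_nat (N choose l) * of_real (- \<epsilon>) ^ l
      * (poly ((pderiv ^^ l) (smult (A k) (p k j))) (w j) * poly ((pderiv ^^ l) (q k j)) (v j))) \<noteq> 0"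
    proof (rule mixed_derivative_power_nz[OF _ _ _ eps])
      show "Im (w j) > 0" "Im (v j) > 0" using insert.prems by (auto simp: upperD)
      fix x y :: complex assume xy: "Im x > 0" "Im y > 0"
      have upd: "w(j := x) \<in> upper" "v(j := y) \<in> upper"
        using insert.prems xy by (auto simp: upper_def)
      have "(\<Prod>i\<in>S. M k i (w(j := x)) (v(j := y))) = (\<Prod>i\<in>S. M k i w v)" for k
        using insert.hyps by (intro prod.cong) (auto simp: M_def)
      moreover have "(\<Prod>i\<in>-S. P k i (w(j := x)) (v(j := y))) =
          poly (p k j) x * poly (q k j) y * (\<Prod>i\<in>-insert j S. P k i w v)" for k
      proof -
        have "- S = insert j (- insert j S)" using insert.hyps by auto
        then have "(\<Prod>i\<in>-S. P k i (w(j := x)) (v(j := y))) =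
            P k j (w(j := x)) (v(j := y)) * (\<Prod>i\<in>-insert j S. P k i (w(j := x)) (v(j := y)))"
          by (metis ComplD finite insertI1 prod.insert)
        also have "(\<Prod>i\<in>-insert j S. P k i (w(j := x)) (v(j := y))) = (\<Prod>i\<in>-insert j S. P k i w v)"
          by (intro prod.cong) (auto simp: P_def)
        finally show ?thesis by (simp add: P_def)
      qed
      ultimately show "(\<Sum>k\<in>K. poly (smult (A k) (p k j)) x * poly (q k j) y) \<noteq> 0"
        using insert.IH[OF upd] by (simp add: A_def mult_ac del: fun_upd_apply)
    qed
    moreover have "(\<Sum>l\<le>N. of_nat (N choose l) * of_real (- \<epsilon>) ^ l
      * (poly ((pderiv ^^ l) (smult (A k) (p k j))) (w j) * poly ((pderiv ^^ l) (q k j)) (v j))) =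
      A k * M k j w v" for k
      by (simp add: M_def mixed_power_def higher_pderiv_smult sum_distrib_left mult_ac)
    ultimately show ?case
      using insert.hyps by (simp add: A_def mult_ac)
  qed
  from this[of UNIV] show ?thesis by (simp add: M_def)
qed

text \<open>For \<open>\<epsilon> = 1 / N\<close> this is \<open>mixed_power\<close> applied to \<open>(-w)\<^sup>b v\<^sup>c\<close> at \<open>w = i \<epsilon>\<close>, in a form
  that is continuous at \<open>\<epsilon> = 0\<close>.\<close>

definition mixed_limit :: "real \<Rightarrow> nat \<Rightarrow> nat \<Rightarrow> complex \<Rightarrow> complex" where
  "mixed_limit \<epsilon> b c v = (\<Sum>l\<le>b. (\<Prod>m<l. 1 - of_nat m * of_real \<epsilon>) / fact l * (- 1) ^ l *
    (poly ((pderiv ^^ l) (monom ((- 1) ^ b) b)) (\<i> * of_real \<epsilon>) * poly ((pderiv ^^ l) (monom 1 c)) v))"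

lemma higher_pderiv_monom_eq_0: "(pderiv ^^ l) (monom x b) = 0" if "l > b" for x :: complex
  using that by (intro poly_eqI) (simp add: coeff_higher_pderiv)

text \<open>Rests on \<open>(N choose l) / N ^ l = (\<Prod>m<l. 1 - m / N) / fact l\<close>.
  Binomials vanish for \<open>l > N\<close> and derivatives for \<open>l > b\<close>, so both sums
  can be compared with the one up to \<open>N + b\<close>.\<close>

lemma mixed_limit_inverse:
  assumes "N > 0"
  shows "mixed_limit (1 / N) b c v =
    mixed_power N (1 / N) (monom ((- 1) ^ b) b) (monom 1 c) (\<i> * of_real (1 / N)) v"
proof -
  define f where "f = (\<lambda>l. poly ((pderiv ^^ l) (monom ((- 1) ^ b) b)) (\<i> * of_real (1 / N))
    * poly ((pderiv ^^ l) (monom 1 c)) v)"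
  have coeff: "complex_of_nat (N choose l) * of_real (- (1 / real N)) ^ l =
      (\<Prod>m<l. 1 - of_nat m * of_real (1 / real N)) / fact l * (- 1) ^ l" for l
  proof -
    define x where "x = complex_of_real (1 / real N)"
    have "of_nat N * x = 1" using assms by (simp add: x_def)
    then have "(\<Prod>m<l. 1 - of_nat m * x) = (\<Prod>m<l. (of_nat N - of_nat m) * x)"
      by (simp add: algebra_simps)
    also have "\<dots> = (\<Prod>m<l. of_nat N - of_nat m) * x ^ l"
      by (simp add: prod.distrib)
    also have "(\<Prod>m<l. of_nat N - of_nat m) = complex_of_nat (N choose l) * fact l"
      by (simp add: binomial_gbinomial gbinomial_prod_rev atLeast0LessThan)
    moreover have "complex_of_real (- (1 / real N)) ^ l = x ^ l * (- 1) ^ l"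
      by (simp add: x_def flip: power_mult_distrib)
    ultimately show ?thesis by (simp add: x_def)
  qed
  have "mixed_limit (1 / N) b c v = (\<Sum>l\<le>N + b. complex_of_nat (N choose l) * of_real (- (1 / real N)) ^ l * f l)"
    unfolding mixed_limit_def coeff f_def
    by (intro sum.mono_neutral_left) (auto simp: higher_pderiv_monom_eq_0)
  also have "\<dots> = mixed_power N (1 / N) (monom ((- 1) ^ b) b) (monom 1 c) (\<i> * of_real (1 / N)) v"
    unfolding mixed_power_def f_def
    by (intro sum.mono_neutral_right) (auto simp: binomial_eq_0)
  finally show ?thesis .
qed

text \<open>At \<open>w = 0\<close> the derivatives of \<open>(- w) ^ b\<close> of order below
  \<open>b\<close> vanish, so only \<open>l = b\<close> remains; there \<open>fact b\<close>
  cancels, and so do the two signs \<open>(- 1) ^ b\<close>.\<close>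

lemma mixed_limit_0: "mixed_limit 0 b c v = poly ((pderiv ^^ b) (monom 1 c)) v"
proof -
  have "mixed_limit 0 b c v = (\<Sum>l\<in>{b}. (\<Prod>m<l. 1 - of_nat m * of_real 0) / fact l * (- 1) ^ l *
    (poly ((pderiv ^^ l) (monom ((- 1) ^ b) b)) (\<i> * of_real 0) * poly ((pderiv ^^ l) (monom 1 c)) v))"
    unfolding mixed_limit_def
    by (intro sum.mono_neutral_right) (auto simp: poly_0_coeff_0 coeff_higher_pderiv)
  also have "\<dots> = poly ((pderiv ^^ b) (monom 1 c)) v"
    by (simp add: poly_0_coeff_0 coeff_higher_pderiv flip: pochhammer_fact power_mult_distrib)
  finally show ?thesis .
qed

lemma weyl_op_stable_or_zero:
  fixes a :: "'n::finite weyl_coeffs"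
  assumes sym: "\<And>z w. z \<in> upper \<Longrightarrow> w \<in> upper \<Longrightarrow> symbol a z w \<noteq> 0"
    and f: "\<And>z. z \<in> upper \<Longrightarrow> eval_cpoly f z \<noteq> 0"
  shows "(\<forall>z\<in>upper. eval_cpoly (weyl_op a f) z \<noteq> 0) \<or> (\<forall>z\<in>upper. eval_cpoly (weyl_op a f) z = 0)"
proof -
  define K where "K = Poly_Mapping.keys a \<times> Poly_Mapping.keys f"
  \<comment> \<open>The monomial in \<open>z\<close> is kept in the coefficient, so that the
    derivatives act on \<open>w\<close> and \<open>v\<close> only; \<open>v = z\<close> is
    substituted afterwards.\<close>
  define c where "c = (\<lambda>k z. Poly_Mapping.lookup a (fst k) * Poly_Mapping.lookup f (snd k) * mval (fst (fst k)) z)"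
  define p where "p = (\<lambda>(k :: ('n multi_index \<times> 'n multi_index) \<times> 'n multi_index) i.
      monom ((- 1 :: complex) ^ Poly_Mapping.lookup (snd (fst k)) i) (Poly_Mapping.lookup (snd (fst k)) i))"
  define q where "q = (\<lambda>(k :: ('n multi_index \<times> 'n multi_index) \<times> 'n multi_index) i.
      monom (1 :: complex) (Poly_Mapping.lookup (snd k) i))"
  define g where "g = (\<lambda>z \<epsilon>. \<Sum>k\<in>K. c k z * (\<Prod>i\<in>UNIV.
      mixed_limit \<epsilon> (Poly_Mapping.lookup (snd (fst k)) i) (Poly_Mapping.lookup (snd k) i) (z i)))"
  have g0: "g z 0 = eval_cpoly (weyl_op a f) z" for z
    unfolding eval_weyl_op eval_multi_deriv g_def K_def c_def mixed_limit_0
    by (simp add: sum_distrib_left mult_ac sum.cartesian_product case_prod_unfold)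
  have gN: "g z (1 / N) \<noteq> 0" if "N > 0" "z \<in> upper" for N :: nat and z
  proof -
    have "(\<Sum>k\<in>K. c k z * (\<Prod>i\<in>UNIV. poly (p k i) (w i) * poly (q k i) (v i))) =
        symbol a z w * eval_cpoly f v" for w v
    proof -
      have "(\<Prod>i\<in>UNIV. poly (p k i) (w i) * poly (q k i) (v i)) =
          mval (snd (fst k)) (\<lambda>i. - w i) * mval (snd k) v" for k
        unfolding prod.distrib mval_def p_def q_def poly_monom
        by (simp add: power_minus[of "w i" for i] prod.distrib)
      then show ?thesis
        by (simp add: symbol_def eval_cpoly_superset[OF finite_keys order.refl, of f] K_def c_def
            sum_product sum.cartesian_product' mult_ac)
           (rule sum.swap)
    qed
    then have "(\<Sum>k\<in>K. c k z * (\<Prod>i\<in>UNIV.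
        mixed_power N (1 / N) (p k i) (q k i) (\<i> * of_real (1 / N)) (z i))) \<noteq> 0"
      using that sym[OF \<open>z \<in> upper\<close>] f
      by (intro mixed_power_coordinates_nz[where w = "\<lambda>_. \<i> * of_real (1 / N)"])
         (auto intro: upperI)
    then show ?thesis
      by (simp add: g_def p_def q_def mixed_limit_inverse[OF \<open>N > 0\<close>])
  qed
  have "(\<forall>z\<in>upper. g z 0 \<noteq> 0) \<or> (\<forall>z\<in>upper. g z 0 = 0)"
  proof (rule hurwitz_upper)
    show "(\<lambda>k. 1 / real (Suc k)) \<longlonglongrightarrow> 0"
      by (rule LIMSEQ_Suc) (rule lim_1_over_n)
    show "\<forall>\<^sub>F k in sequentially. (\<forall>z\<in>upper. g z (1 / real (Suc k)) \<noteq> 0) \<or>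
        (\<forall>z\<in>upper. g z (1 / real (Suc k)) = 0)"
      using gN[of "Suc _"] by (intro always_eventually) blast
    fix z0 z1 :: "'n \<Rightarrow> complex"
    show "continuous_on UNIV (\<lambda>x. g (\<lambda>i. z0 i + snd x * (z1 i - z0 i)) (fst x))"
      unfolding g_def mixed_limit_def c_def mval_def by (intro continuous_intros) auto
    show "(\<lambda>t. g (\<lambda>i. z0 i + t * (z1 i - z0 i)) \<epsilon>) holomorphic_on UNIV" for \<epsilon>
      unfolding g_def mixed_limit_def c_def mval_def poly_altdef by (intro holomorphic_intros) auto
  qed
  then show ?thesis by (simp add: g0)
qed

section \<open>Zeros of the symbol in the second argument\<close>

definition stable_or_zero :: "(('n \<Rightarrow> complex) \<Rightarrow> complex) \<Rightarrow> bool" where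
  "stable_or_zero g \<longleftrightarrow> (\<forall>z\<in>upper. g z \<noteq> 0) \<or> (\<forall>z\<in>upper. g z = 0)"

text \<open>Differentiation lowers degrees, so the left side has degree below
  \<open>degree p + degree q\<close>, which is the degree of the right side unless
  \<open>c = 0\<close>.\<close>

lemma wronskian_eq_smult_mult_imp:
  fixes p q :: "complex poly"
  assumes eq: "pderiv p * q - pderiv q * p = smult c (p * q)" and "degree p > 0" "degree q > 0"
  shows "c = 0"
proof (rule ccontr)
  assume "c \<noteq> 0"
  have nz: "p \<noteq> 0" "q \<noteq> 0" using assms by auto
  have "degree (pderiv p * q - pderiv q * p) < degree p + degree q"
    using assms(2,3) degree_mult_le[of "pderiv p" q] degree_mult_le[of "pderiv q" p]
    by (intro degree_diff_less) (auto simp: degree_pderiv)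
  moreover have "degree (smult c (p * q)) = degree p + degree q"
    using nz \<open>c \<noteq> 0\<close> by (simp add: degree_mult_eq)
  ultimately show False using eq by simp
qed

text \<open>Near a zero of order \<open>k\<close> the logarithmic derivative is
  \<open>k / (t - t0)\<close> plus a bounded term. Approaching \<open>t0\<close> vertically from
  below, with \<open>t - t0 = - \<i> * \<tau>\<close>, the imaginary part of the first term is
  \<open>k / \<tau>\<close>.\<close>

lemma infinite_log_deriv_large:
  fixes p :: "complex poly"
  assumes "p \<noteq> 0" "poly p t0 = 0" "Im t0 > 0"
  shows "infinite {t. Im t > 0 \<and> poly p t \<noteq> 0 \<and> Im (poly (pderiv p) t / poly p t) > C}"
proof -
  define k where "k = order t0 p"
  have "k > 0" using assms by (auto simp: k_def order_root)
  then obtain m where k: "k = Suc m" using gr0_implies_Suc by blast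
  obtain r where p: "p = [:- t0, 1:] ^ k * r" and "\<not> [:- t0, 1:] dvd r"
    using order_decomp[OF assms(1), of t0] by (auto simp: k_def)
  then have r0: "poly r t0 \<noteq> 0" by (simp add: poly_eq_0_iff_dvd)
  have ld: "poly (pderiv p) t / poly p t = of_nat k / (t - t0) + poly (pderiv r) t / poly r t"
    if "t \<noteq> t0" "poly r t \<noteq> 0" for t
  proof -
    have dp: "poly (pderiv p) t = of_nat k * (t - t0) ^ m * poly r t + (t - t0) ^ k * poly (pderiv r) t"
      unfolding p pderiv_mult k pderiv_power_Suc
      by (simp add: pderiv_pCons algebra_simps)
    have "poly p t = (t - t0) ^ k * poly r t"
      by (simp add: p)
    then show ?thesis unfolding dp using that
      by (simp add: k divide_simps) (simp add: algebra_simps)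
  qed
  define T where "T = (\<lambda>\<tau>::real. t0 - \<i> * of_real \<tau>)"
  have T: "(T \<longlongrightarrow> t0) (at_right 0)"
    unfolding T_def by (rule tendsto_eq_intros refl)+ simp
  have "((\<lambda>\<tau>. Im (poly (pderiv r) (T \<tau>) / poly r (T \<tau>))) \<longlongrightarrow> Im (poly (pderiv r) t0 / poly r t0)) (at_right 0)"
    by (intro tendsto_intros T r0)
  moreover have "filterlim (\<lambda>\<tau>. real k * inverse \<tau>) at_top (at_right 0)"
    using \<open>k > 0\<close> by (intro filterlim_tendsto_pos_mult_at_top[OF tendsto_const] filterlim_inverse_at_top_right) auto
  ultimately have "filterlim (\<lambda>\<tau>. Im (poly (pderiv r) (T \<tau>) / poly r (T \<tau>)) + real k * inverse \<tau>) at_top (at_right 0)"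
    by (rule filterlim_tendsto_add_at_top)
  then have ev1: "\<forall>\<^sub>F \<tau> in at_right 0. C < Im (poly (pderiv r) (T \<tau>) / poly r (T \<tau>)) + real k * inverse \<tau>"
    by (auto simp: filterlim_at_top_dense)
  have ev2: "\<forall>\<^sub>F \<tau> in at_right 0. poly r (T \<tau>) \<noteq> 0"
    using r0 by (intro tendsto_imp_eventually_ne[of _ "poly r t0"] tendsto_intros T)
  have "((\<lambda>\<tau>. Im (T \<tau>)) \<longlongrightarrow> Im t0) (at_right 0)" by (intro tendsto_intros T)
  then have ev3: "\<forall>\<^sub>F \<tau> in at_right 0. Im (T \<tau>) > 0"
    using assms(3) by (rule order_tendstoD)
  have "\<forall>\<^sub>F \<tau> in at_right 0. T \<tau> \<in> {t. Im t > 0 \<and> poly p t \<noteq> 0 \<and> Im (poly (pderiv p) t / poly p t) > C}"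
    using ev1 ev2 ev3 eventually_at_right_less[of 0]
  proof eventually_elim
    case (elim \<tau>)
    have ne: "T \<tau> \<noteq> t0" using elim(4) by (simp add: T_def)
    have "Im (of_nat k / (T \<tau> - t0)) = real k * inverse \<tau>"
      using elim(4) by (simp add: T_def field_simps Im_divide power2_eq_square)
    then have "Im (poly (pderiv p) (T \<tau>) / poly p (T \<tau>)) > C"
      using ld[OF ne elim(2)] elim(1) by simp
    moreover have "poly p (T \<tau>) \<noteq> 0"
      using ne elim(2) by (simp add: p)
    ultimately show ?case using elim(3) by simp
  qed
  then obtain b where b: "b > 0" "\<And>\<tau>. 0 < \<tau> \<Longrightarrow> \<tau> < b \<Longrightarrow>
      T \<tau> \<in> {t. Im t > 0 \<and> poly p t \<noteq> 0 \<and> Im (poly (pderiv p) t / poly p t) > C}"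
    by (auto simp: eventually_at_right_field)
  have "infinite (T ` {0<..<b})"
    using b(1) by (subst finite_image_iff) (auto simp: inj_on_def T_def)
  moreover have "T ` {0<..<b} \<subseteq> {t. Im t > 0 \<and> poly p t \<noteq> 0 \<and> Im (poly (pderiv p) t / poly p t) > C}"
    using b(2) by auto
  ultimately show ?thesis using finite_subset by blast
qed

text \<open>If \<open>B(\<sqdot>, w)\<close> vanishes for some \<open>w\<close>, move one coordinate \<open>w\<^sub>j = t\<close> to leave the zero set of
  \<open>B(z, \<sqdot>)\<close>, which does not depend on \<open>z\<close>. Near a zero the logarithmic derivative \<open>L\<^sub>z(t)\<close> in \<open>t\<close> takes
  values \<open>z\<^sub>j + c\<close> with \<open>Im c > 0\<close>, and the last assumption then makes \<open>L\<^sub>z(t) - z\<^sub>j\<close> independent of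
  \<open>z\<close>. This is impossible for degree reasons.\<close>

lemma nonzero_of_stable_or_zero:
  fixes B :: "('n::finite \<Rightarrow> complex) \<Rightarrow> ('n \<Rightarrow> complex) \<Rightarrow> complex"
  assumes A: "\<And>j z w t. poly (A j z w) t = B z (w(j := t))"
    and s1: "\<And>w. w \<in> upper \<Longrightarrow> stable_or_zero (\<lambda>z. B z w)"
    and s2: "\<And>w c j. w \<in> upper \<Longrightarrow> Im c > 0 \<Longrightarrow>
      stable_or_zero (\<lambda>z. B z w * (z j + c) - poly (pderiv (A j z w)) (w j))"
    and ne: "z1 \<in> upper" "w1 \<in> upper" "B z1 w1 \<noteq> 0"
    and zw: "z \<in> upper" "w0 \<in> upper"
  shows "B z w0 \<noteq> 0"
proof
  assume "B z w0 = 0"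
  define vanish where "vanish = (\<lambda>w. \<forall>z\<in>upper. B z w = 0)"
  have v0: "vanish w0"
    using \<open>B z w0 = 0\<close> zw s1[OF zw(2)] by (auto simp: stable_or_zero_def vanish_def)
  obtain j w t where w: "w \<in> upper" "Im t > 0" "vanish w" "\<not> vanish (w(j := t))"
  proof (rule ccontr)
    assume "\<not> thesis"
    then have step: "vanish (w(j := t))" if "w \<in> upper" "Im t > 0" "vanish w" for w j t
      using that \<open>\<And>w t j. w \<in> upper \<Longrightarrow> Im t > 0 \<Longrightarrow> vanish w \<Longrightarrow> \<not> vanish (w(j := t)) \<Longrightarrow> thesis\<close> by blast
    \<comment> \<open>The coordinates of \<open>w0\<close> are exchanged for those of
      \<open>w1\<close> one at a time; if no single exchange left the vanishing set,
      \<open>w1\<close> would belong to it.\<close>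
    have "vanish (\<lambda>i. if i \<in> S then w1 i else w0 i)" for S
      using finite[of S]
    proof (induction S rule: finite_induct)
      case (insert j S)
      have "(\<lambda>i. if i \<in> insert j S then w1 i else w0 i) = (\<lambda>i. if i \<in> S then w1 i else w0 i)(j := w1 j)"
        by auto
      then show ?case
        using step[OF _ _ insert.IH, of "w1 j" j] ne(2) zw(2) by (auto simp: upper_def)
    qed (use v0 in simp)
    from this[of UNIV] show False using ne by (auto simp: vanish_def)
  qed
  \<comment> \<open>The shift by \<open>\<i>\<close> in coordinate \<open>j\<close> becomes the
    nonzero constant in the Wronskian identity below.\<close>
  define z' where "z' = z(j := z j + \<i>)"
  have z': "z' \<in> upper" using zw(1) by (auto simp: z'_def upper_def add_pos_pos)
  define p where "p = A j z w"
  define q where "q = A j z' w"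
  have pq: "poly p u = B z (w(j := u))" "poly q u = B z' (w(j := u))" for u
    by (simp_all add: p_def q_def A)
  have upd: "w(j := u) \<in> upper" if "Im u > 0" for u
    using w(1) that by (auto simp: upper_def)
  have "poly p t \<noteq> 0" "poly q t \<noteq> 0"
    using s1[OF upd[OF w(2)]] w(4) zw(1) z' by (auto simp: pq stable_or_zero_def vanish_def)
  then have "p \<noteq> 0" "q \<noteq> 0" by auto
  have roots: "poly p (w j) = 0" "poly q (w j) = 0"
    using w(3) zw(1) z' by (auto simp: pq vanish_def)
  then have deg: "degree p > 0" "degree q > 0"
    using \<open>poly p t \<noteq> 0\<close> \<open>poly q t \<noteq> 0\<close> by (auto elim!: degree_eq_zeroE intro!: gr0I)
  define E where "E = {u. Im u > 0 \<and> poly p u \<noteq> 0 \<and> Im (poly (pderiv p) u / poly p u) > Im (z j)}"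
  have "infinite E"
    unfolding E_def using \<open>p \<noteq> 0\<close> roots w(1) by (intro infinite_log_deriv_large) (auto simp: upperD)
  moreover have "E \<subseteq> {u. poly (pderiv p * q - pderiv q * p - smult (- \<i>) (p * q)) u = 0}"
  proof
    fix u assume u: "u \<in> E"
    \<comment> \<open>Chosen so that the function of the second family vanishes at \<open>z\<close>,
      and therefore also at \<open>z'\<close>. The threshold \<open>Im (z j)\<close> in
      \<open>E\<close> is what makes \<open>Im c\<close> positive.\<close>
    define c where "c = poly (pderiv p) u / poly p u - z j"
    have "Im c > 0" "Im u > 0" "poly p u \<noteq> 0" using u by (auto simp: E_def c_def)
    have AA: "A j x (w(j := u)) = A j x w" for x
      unfolding poly_eq_poly_eq_iff[symmetric] by (intro ext) (simp add: A)
    have "stable_or_zero (\<lambda>x. B x (w(j := u)) * (x j + c) - poly (pderiv (A j x w)) u)"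
      using s2[OF upd[OF \<open>Im u > 0\<close>] \<open>Im c > 0\<close>, of j] by (simp add: AA)
    moreover have "B z (w(j := u)) * (z j + c) - poly (pderiv (A j z w)) u = 0"
      using \<open>poly p u \<noteq> 0\<close> by (simp add: c_def flip: pq p_def)
    ultimately have "B z' (w(j := u)) * (z' j + c) - poly (pderiv (A j z' w)) u = 0"
      using zw(1) z' unfolding stable_or_zero_def by blast
    then have "poly (pderiv q) u = poly q u * (z' j + c)"
      by (simp add: pq(2) flip: q_def)
    moreover have "z' j = z j + \<i>"
      by (simp add: z'_def)
    moreover have "poly (pderiv p) u = poly p u * (z j + c)"
      using \<open>poly p u \<noteq> 0\<close> by (simp add: c_def)
    ultimately show "u \<in> {u. poly (pderiv p * q - pderiv q * p - smult (- \<i>) (p * q)) u = 0}"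
      by (simp add: algebra_simps)
  qed
  ultimately have "infinite {u. poly (pderiv p * q - pderiv q * p - smult (- \<i>) (p * q)) u = 0}"
    using finite_subset by blast
  then have "pderiv p * q - pderiv q * p - smult (- \<i>) (p * q) = 0"
    using poly_roots_finite by blast
  then have "pderiv p * q - pderiv q * p = smult (- \<i>) (p * q)"
    by (simp only: right_minus_eq)
  then have "- \<i> = (0::complex)"
    using deg by (rule wronskian_eq_smult_mult_imp)
  then show False by simp
qed

section \<open>Test polynomials\<close>

text \<open>The power tends to \<open>exp (- w * x)\<close> as \<open>N\<close> grows; the linear
  factor will be \<open>1\<close> or \<open>x + c\<close>.\<close>

definition exp_factor :: "nat \<Rightarrow> complex \<Rightarrow> complex \<Rightarrow> complex \<Rightarrow> complex poly" where
  "exp_factor N w c d = [:1, - w / of_nat N:] ^ N * [:c, d:]"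

text \<open>With \<open>\<epsilon> = 1 / N\<close>, this is the \<open>k\<close>-th derivative of
  \<open>exp_factor\<close> divided by \<open>(1 - w * z / N) ^ (N - M)\<close>. Leaving the
  exponent \<open>M - k\<close>, for a fixed bound \<open>M\<close> on the order, makes it
  polynomial in \<open>\<epsilon>\<close>. The truncated \<open>k - 1\<close> is harmless at
  \<open>k = 0\<close>, where its term has the factor \<open>0\<close>.\<close>

definition exp_factor_limit :: "real \<Rightarrow> nat \<Rightarrow> nat \<Rightarrow> complex \<Rightarrow> complex \<Rightarrow> complex \<Rightarrow> complex \<Rightarrow> complex" where
  "exp_factor_limit \<epsilon> M k w c d z =
    (- w) ^ k * (\<Prod>m<k. 1 - of_nat m * of_real \<epsilon>) * (1 - of_real \<epsilon> * w * z) ^ (M - k) * (c + d * z) +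
    of_nat k * d * (- w) ^ (k - 1) * (\<Prod>m<k - 1. 1 - of_nat m * of_real \<epsilon>) * (1 - of_real \<epsilon> * w * z) ^ (M - (k - 1))"

lemma higher_pderiv_linear_power:
  fixes x :: complex
  assumes "k \<le> N"
  shows "(pderiv ^^ k) ([:1, x:] ^ N) = smult (x ^ k * (\<Prod>m<k. of_nat N - of_nat m)) ([:1, x:] ^ (N - k))"
  using assms
proof (induction k)
  case (Suc k)
  then obtain m where m: "N - k = Suc m" "N - Suc k = m" "of_nat N - of_nat k = (1 + of_nat m :: complex)"
    by (metis Suc_diff_Suc Suc_le_eq diff_Suc_Suc diff_Suc_1 less_imp_le_nat of_nat_Suc of_nat_diff)
  have "(pderiv ^^ Suc k) ([:1, x:] ^ N) = pderiv ((pderiv ^^ k) ([:1, x:] ^ N))"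
    by simp
  also have "\<dots> = smult (x ^ k * (\<Prod>m<k. of_nat N - of_nat m)) (pderiv ([:1, x:] ^ Suc m))"
    using Suc by (simp add: pderiv_smult m)
  also have "pderiv ([:1, x:] ^ Suc m) = smult (x * (1 + of_nat m)) ([:1, x:] ^ m)"
    by (subst pderiv_power_Suc) (simp add: pderiv_pCons algebra_simps)
  finally show ?case
    using m by (simp add: mult_ac del: power_Suc) (simp add: mult_ac)
qed simp

lemma higher_pderiv_mult_linear:
  fixes p :: "complex poly"
  shows "(pderiv ^^ k) (p * [:c, d:]) = (pderiv ^^ k) p * [:c, d:] + smult (of_nat k * d) ((pderiv ^^ (k - 1)) p)"
proof (induction k)
  case (Suc k)
  have "(pderiv ^^ Suc k) (p * [:c, d:]) =
      pderiv ((pderiv ^^ k) p * [:c, d:]) + smult (of_nat k * d) (pderiv ((pderiv ^^ (k - 1)) p))"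
    using Suc by (simp add: pderiv_add pderiv_smult)
  also have "smult (of_nat k * d) (pderiv ((pderiv ^^ (k - 1)) p)) = smult (of_nat k * d) ((pderiv ^^ k) p)"
    by (cases k) simp_all
  also have "pderiv ((pderiv ^^ k) p * [:c, d:]) = (pderiv ^^ Suc k) p * [:c, d:] + smult d ((pderiv ^^ k) p)"
    unfolding pderiv_mult by (simp add: pderiv_pCons)
  finally show ?case by (simp add: smult_add_left algebra_simps)
qed simp

lemma higher_pderiv_exp_factor:
  assumes "N > 0" "k \<le> M" "M \<le> N"
  shows "poly ((pderiv ^^ k) (exp_factor N w c d)) z =
    (1 - of_real (1 / N) * w * z) ^ (N - M) * exp_factor_limit (1 / N) M k w c d z"
proof -
  define e where "e = complex_of_real (1 / N)"
  have e: "- w / of_nat N = e * - w" "of_nat N * e = 1"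
    using assms by (auto simp: e_def)
  have *: "poly ((pderiv ^^ l) ([:1, - w / of_nat N:] ^ N)) z =
      (- w) ^ l * (\<Prod>m<l. 1 - of_nat m * e) * (1 - e * w * z) ^ (M - l) * (1 - e * w * z) ^ (N - M)"
    if "l \<le> M" for l
  proof -
    have "(e * - w) ^ l * (\<Prod>m<l. of_nat N - of_nat m) = (- w) ^ l * (\<Prod>m<l. (of_nat N - of_nat m) * e)"
      by (simp only: power_mult_distrib prod.distrib prod_constant card_lessThan mult_ac)
    also have "(\<Prod>m<l. (of_nat N - of_nat m) * e) = (\<Prod>m<l. 1 - of_nat m * e)"
      using e(2) by (simp add: algebra_simps)
    finally have "(e * - w) ^ l * (\<Prod>m<l. of_nat N - of_nat m) = (- w) ^ l * (\<Prod>m<l. 1 - of_nat m * e)" .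
    moreover have "poly ((pderiv ^^ l) ([:1, - w / of_nat N:] ^ N)) z =
        (e * - w) ^ l * (\<Prod>m<l. of_nat N - of_nat m) * (1 - e * w * z) ^ (N - l)"
    proof -
      have "poly [:1, e * - w:] z = 1 - e * w * z" by simp
      moreover have "l \<le> N" using that assms by simp
      ultimately show ?thesis
        by (simp only: e(1) higher_pderiv_linear_power poly_smult poly_power)
    qed
    moreover have "(1 - e * w * z) ^ (N - l) = (1 - e * w * z) ^ (M - l) * (1 - e * w * z) ^ (N - M)"
      using that assms by (simp flip: power_add)
    ultimately show ?thesis by (simp only: mult.assoc)
  qed
  show ?thesis
    unfolding exp_factor_def higher_pderiv_mult_linear poly_add poly_mult poly_smult
      exp_factor_limit_def e_def[symmetric]
    using *[of k] *[of "k - 1"] assms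
    by (simp add: algebra_simps)
qed

lemma exp_factor_limit_0:
  "exp_factor_limit 0 M k w c d z = (- w) ^ k * (c + d * z) + of_nat k * d * (- w) ^ (k - 1)"
  by (simp add: exp_factor_limit_def)

definition test_poly :: "nat \<Rightarrow> ('n \<Rightarrow> complex) \<Rightarrow> ('n \<Rightarrow> complex) \<Rightarrow> ('n \<Rightarrow> complex) \<Rightarrow> 'n::finite cpoly" where
  "test_poly N w c d = tensor_cpoly (\<lambda>i. exp_factor N (w i) (c i) (d i))"

text \<open>At \<open>\<epsilon> = 0\<close> this is e^(z.w) T(e^(-z.w) \<Prod>_i (c_i + d_i z_i)),
  with T extended to such exponentials.\<close>

definition test_limit :: "'n::finite weyl_coeffs \<Rightarrow> nat \<Rightarrow> ('n \<Rightarrow> complex) \<Rightarrow> ('n \<Rightarrow> complex) \<Rightarrow> ('n \<Rightarrow> complex) \<Rightarrow>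
    ('n \<Rightarrow> complex) \<Rightarrow> real \<Rightarrow> complex" where
  "test_limit a M w c d z \<epsilon> = (\<Sum>k\<in>Poly_Mapping.keys a. Poly_Mapping.lookup a k * mval (fst k) z *
    (\<Prod>i\<in>UNIV. exp_factor_limit \<epsilon> M (Poly_Mapping.lookup (snd k) i) (w i) (c i) (d i) (z i)))"

definition order_bound :: "'n::finite weyl_coeffs \<Rightarrow> nat \<Rightarrow> bool" where
  "order_bound a M \<longleftrightarrow> (\<forall>k\<in>Poly_Mapping.keys a. \<forall>i. Poly_Mapping.lookup (snd k) i \<le> M)"

lemma ex_order_bound: "\<exists>M. order_bound (a :: 'n::finite weyl_coeffs) M"
proof -
  let ?X = "(\<lambda>(k, i). Poly_Mapping.lookup (snd k) i) ` (Poly_Mapping.keys a \<times> UNIV)"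
  have "finite ?X" by simp
  then have "Poly_Mapping.lookup (snd k) i \<le> Max ?X" if "k \<in> Poly_Mapping.keys a" for k i
    using that by (intro Max_ge) force+
  then show ?thesis unfolding order_bound_def by blast
qed

lemma eval_test_poly:
  "eval_cpoly (test_poly N w c d) z =
    (\<Prod>i\<in>UNIV. (1 - of_real (1 / N) * w i * z i) ^ N * (c i + d i * z i))"
  by (simp add: test_poly_def eval_tensor_cpoly exp_factor_def algebra_simps)

lemma eval_weyl_op_test_poly:
  assumes "order_bound a M" "N > 0" "M \<le> N"
  shows "eval_cpoly (weyl_op a (test_poly N w c d)) z =
    (\<Prod>i\<in>UNIV. (1 - of_real (1 / N) * w i * z i) ^ (N - M)) * test_limit a M w c d z (1 / N)"
proof -
  have "(\<Prod>i\<in>UNIV. poly ((pderiv ^^ Poly_Mapping.lookup (snd k) i) (exp_factor N (w i) (c i) (d i))) (z i)) =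
      (\<Prod>i\<in>UNIV. (1 - of_real (1 / N) * w i * z i) ^ (N - M)) *
      (\<Prod>i\<in>UNIV. exp_factor_limit (1 / N) M (Poly_Mapping.lookup (snd k) i) (w i) (c i) (d i) (z i))"
    if "k \<in> Poly_Mapping.keys a" for k
    using that assms
    by (subst prod.distrib[symmetric], intro prod.cong refl higher_pderiv_exp_factor) (auto simp: order_bound_def)
  then show ?thesis
    by (simp add: test_poly_def eval_weyl_op_tensor test_limit_def sum_distrib_left mult_ac)
qed

text \<open>A zero would give \<open>z = N / w\<close>, a point of the lower half plane. For
  \<open>N = 0\<close> the subtracted term is \<open>0\<close>, since
  \<open>1 / 0 = 0\<close>.\<close>

lemma one_minus_mult_nz:
  assumes "Im w > 0" "Im z > 0"
  shows "1 - of_real (1 / real N) * w * z \<noteq> 0"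
proof
  assume eq: "1 - of_real (1 / real N) * w * z = 0"
  then have "N \<noteq> 0" by (auto intro: ccontr)
  then have "w * z = of_nat N" using eq by (simp add: field_simps)
  moreover have "w \<noteq> 0" using assms by auto
  ultimately have "z = of_nat N * inverse w" by (simp add: field_simps)
  moreover have "Im (of_nat N * x) = real N * Im x" for x by simp
  ultimately have "Im z = real N * Im (inverse w)" by (simp only:)
  then show False
    using mult_nonneg_nonpos[of "real N" "Im (inverse w)"] Im_inverse_neg[OF assms(1)] assms(2)
    by linarith
qed

lemma test_poly_nz:
  assumes "w \<in> upper" "\<And>i x. Im x > 0 \<Longrightarrow> c i + d i * x \<noteq> 0" "z \<in> upper"
  shows "eval_cpoly (test_poly N w c d) z \<noteq> 0"
proof -
  have "(1 - of_real (1 / N) * w i * z i) ^ N * (c i + d i * z i) \<noteq> 0" for i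
    using one_minus_mult_nz[OF upperD[OF assms(1)] upperD[OF assms(3)], of N i i]
      assms(2)[OF upperD[OF assms(3)]] by auto
  then show ?thesis
    unfolding eval_test_poly prod_zero_iff[OF finite] by blast
qed

text \<open>The power split off in \<open>eval_weyl_op_test_poly\<close> has no zeros on
  \<open>upper\<close>, so the alternative for the image of the test polynomial passes to
  \<open>test_limit\<close> at \<open>1 / N\<close>, and from there to the limit.\<close>

lemma test_limit_stable_or_zero:
  fixes a :: "'n::finite weyl_coeffs"
  assumes M: "order_bound a M" and w: "w \<in> upper"
    and ev: "\<forall>\<^sub>F N in sequentially. stable_or_zero (\<lambda>z. eval_cpoly (weyl_op a (test_poly N w c d)) z)"
  shows "stable_or_zero (\<lambda>z. test_limit a M w c d z 0)"
  unfolding stable_or_zero_def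
proof (rule hurwitz_upper)
  show "(\<lambda>n. 1 / real n) \<longlonglongrightarrow> 0" by (rule lim_1_over_n)
  show "\<forall>\<^sub>F N in sequentially. (\<forall>z\<in>upper. test_limit a M w c d z (1 / N) \<noteq> 0) \<or>
      (\<forall>z\<in>upper. test_limit a M w c d z (1 / N) = 0)"
    using ev eventually_gt_at_top[of 0] eventually_ge_at_top[of M]
  proof eventually_elim
    case (elim N)
    have "(\<Prod>i\<in>UNIV. (1 - of_real (1 / N) * w i * z i) ^ (N - M)) \<noteq> 0" if "z \<in> upper" for z
    proof -
      have "(1 - of_real (1 / N) * w i * z i) ^ (N - M) \<noteq> 0" for i
        using one_minus_mult_nz[OF upperD[OF w] upperD[OF that], of N i i] by auto
      then show ?thesis unfolding prod_zero_iff[OF finite] by blast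
    qed
    then show ?case
      using elim(1) unfolding stable_or_zero_def eval_weyl_op_test_poly[OF M elim(2,3)] by auto
  qed
  fix z0 z1 :: "'n \<Rightarrow> complex"
  show "continuous_on UNIV (\<lambda>x. test_limit a M w c d (\<lambda>i. z0 i + snd x * (z1 i - z0 i)) (fst x))"
    unfolding test_limit_def exp_factor_limit_def mval_def by (intro continuous_intros)
  show "(\<lambda>t. test_limit a M w c d (\<lambda>i. z0 i + t * (z1 i - z0 i)) \<epsilon>) holomorphic_on UNIV" for \<epsilon>
    unfolding test_limit_def exp_factor_limit_def mval_def by (intro holomorphic_intros)
qed

text \<open>Freezing all variables except \<open>w j\<close> makes the derivative in
  \<open>w j\<close> an algebraic \<open>pderiv\<close>; the value \<open>w j\<close> itself does
  not enter.\<close>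

definition symbol_poly :: "'n::finite weyl_coeffs \<Rightarrow> 'n \<Rightarrow> ('n \<Rightarrow> complex) \<Rightarrow> ('n \<Rightarrow> complex) \<Rightarrow> complex poly" where
  "symbol_poly a j z w = (\<Sum>k\<in>Poly_Mapping.keys a. monom (Poly_Mapping.lookup a k * mval (fst k) z *
    (\<Prod>i\<in>-{j}. (- w i) ^ Poly_Mapping.lookup (snd k) i) * (- 1) ^ Poly_Mapping.lookup (snd k) j)
    (Poly_Mapping.lookup (snd k) j))"

lemma prod_UNIV_remove: "(\<Prod>i\<in>UNIV. f i) = f j * (\<Prod>i\<in>-{j}. f i)"
  for f :: "'n::finite \<Rightarrow> complex"
  by (simp add: prod.remove[of UNIV j] Compl_eq_Diff_UNIV)

lemma poly_symbol_poly: "poly (symbol_poly a j z w) t = symbol a z (w(j := t))"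
proof -
  have "mval \<beta> (\<lambda>i. - (w(j := t)) i) =
      (\<Prod>i\<in>-{j}. (- w i) ^ Poly_Mapping.lookup \<beta> i) * (- 1) ^ Poly_Mapping.lookup \<beta> j * t ^ Poly_Mapping.lookup \<beta> j"
    for \<beta> :: "'a multi_index"
  proof -
    have "(\<Prod>i\<in>-{j}. (- (w(j := t)) i) ^ Poly_Mapping.lookup \<beta> i) = (\<Prod>i\<in>-{j}. (- w i) ^ Poly_Mapping.lookup \<beta> i)"
      by (intro prod.cong) auto
    then show ?thesis
      unfolding mval_def prod_UNIV_remove[of _ j] by (simp add: power_minus[of t])
  qed
  then show ?thesis
    by (simp add: symbol_poly_def symbol_def poly_sum poly_monom mult_ac del: fun_upd_apply)
qed

lemma test_limit_const:
  "test_limit a M w (\<lambda>_. 1) (\<lambda>_. 0) z 0 = symbol a z w"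
  by (simp add: test_limit_def exp_factor_limit_0 symbol_def mval_def)

text \<open>By the Leibniz rule the linear factor contributes an extra term
  \<open>b * (- w) ^ (b - 1)\<close>, which is minus the derivative of \<open>(- w) ^ b\<close>;
  hence the subtraction.\<close>

lemma test_limit_linear:
  "test_limit a M w ((\<lambda>_. 1)(j := c)) ((\<lambda>_. 0)(j := 1)) z 0 =
    symbol a z w * (z j + c) - poly (pderiv (symbol_poly a j z w)) (w j)"
proof -
  let ?b = "\<lambda>k. Poly_Mapping.lookup (snd k)"
  let ?R = "\<lambda>k. Poly_Mapping.lookup a k * mval (fst k) z * (\<Prod>i\<in>-{j}. (- w i) ^ ?b k i)"
  have lim: "test_limit a M w ((\<lambda>_. 1)(j := c)) ((\<lambda>_. 0)(j := 1)) z 0 = (\<Sum>k\<in>Poly_Mapping.keys a.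
      ?R k * ((- w j) ^ ?b k j * (c + z j) + of_nat (?b k j) * (- w j) ^ (?b k j - 1)))"
  proof -
    have "(\<Prod>i\<in>-{j}. exp_factor_limit 0 M (b i) (w i) (((\<lambda>_. 1)(j := c)) i) (((\<lambda>_. 0)(j := 1)) i) (z i)) =
        (\<Prod>i\<in>-{j}. (- w i) ^ b i)" for b
      by (intro prod.cong) (auto simp: exp_factor_limit_0)
    then show ?thesis
      unfolding test_limit_def prod_UNIV_remove[of _ j]
      by (simp add: exp_factor_limit_0 mult_ac)
  qed
  have "symbol a z w = (\<Sum>k\<in>Poly_Mapping.keys a. ?R k * (- w j) ^ ?b k j)"
    by (simp add: symbol_def mval_def prod_UNIV_remove[of _ j] mult_ac)
  moreover have "poly (pderiv (symbol_poly a j z w)) (w j) =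
      - (\<Sum>k\<in>Poly_Mapping.keys a. ?R k * (of_nat (?b k j) * (- w j) ^ (?b k j - 1)))"
  proof -
    have "poly (pderiv (monom (x * (- 1) ^ b) b)) t = - (x * (of_nat b * (- t) ^ (b - 1)))" for x t :: complex and b
      by (cases b) (simp_all add: pderiv_monom poly_monom power_minus[of t])
    then show ?thesis
      by (simp add: symbol_poly_def pderiv_sum poly_sum sum_negf)
  qed
  ultimately show ?thesis
    unfolding lim by (simp add: sum_distrib_left sum.distrib algebra_simps)
qed

lemma symbol_nz_of_test_polys:
  fixes a :: "'n::finite weyl_coeffs"
  assumes test: "\<And>w c d. w \<in> upper \<Longrightarrow> (\<And>i. c i = 1 \<and> d i = 0 \<or> Im (c i) > 0 \<and> d i = 1) \<Longrightarrow>
      stable_or_zero (\<lambda>z. test_limit a M w c d z 0)"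
    and ne: "z1 \<in> upper" "w1 \<in> upper" "symbol a z1 w1 \<noteq> 0"
    and zw: "z \<in> upper" "w \<in> upper"
  shows "symbol a z w \<noteq> 0"
proof (rule nonzero_of_stable_or_zero[where B = "symbol a" and A = "symbol_poly a", OF poly_symbol_poly _ _ ne zw])
  show "stable_or_zero (\<lambda>z. symbol a z w)" if "w \<in> upper" for w
    using test[OF that, of "\<lambda>_. 1" "\<lambda>_. 0"] by (simp add: test_limit_const)
  show "stable_or_zero (\<lambda>z. symbol a z w * (z j + c) - poly (pderiv (symbol_poly a j z w)) (w j))"
    if "w \<in> upper" "Im c > 0" for w c j
    using test[OF that(1), of "(\<lambda>_. 1)(j := c)" "(\<lambda>_. 0)(j := 1)"] that(2)
    unfolding test_limit_linear by simp
qed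

section \<open>Real stability\<close>

lemma infinite_Im_pos: "infinite {z. Im z > 0}"
proof -
  have "inj (\<lambda>n::nat. Complex (real n) 1)" by (auto simp: inj_on_def)
  then have "infinite (range (\<lambda>n::nat. Complex (real n) 1))" by (rule range_inj_infinite)
  moreover have "range (\<lambda>n::nat. Complex (real n) 1) \<subseteq> {z. Im z > 0}" by auto
  ultimately show ?thesis using finite_subset by blast
qed

lemma infinite_Im_neg: "infinite {z. Im z < 0}"
proof -
  have "infinite (uminus ` {z. Im z > 0})"
    using infinite_Im_pos by (simp add: finite_image_iff)
  moreover have "uminus ` {z. Im z > 0} \<subseteq> {z. Im z < 0}" by auto
  ultimately show ?thesis using finite_subset by blast
qed

lemma eval_cpoly_eq_0_imp:
  assumes "\<And>z. z \<in> upper \<Longrightarrow> eval_cpoly p z = 0"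
  shows "p = 0"
proof (rule poly_mapping_eqI)
  fix \<alpha>
  show "Poly_Mapping.lookup p \<alpha> = Poly_Mapping.lookup 0 \<alpha>"
  proof (cases "\<alpha> \<in> Poly_Mapping.keys p")
    case True
    have "Poly_Mapping.lookup p \<alpha> = 0"
    proof (rule sum_monomials_eq_0_imp[where I = UNIV and K = "Poly_Mapping.keys p"
          and d = Poly_Mapping.lookup and S = "\<lambda>_. {z. Im z > 0}"])
      show "(\<Sum>k\<in>Poly_Mapping.keys p. Poly_Mapping.lookup p k * (\<Prod>i\<in>UNIV. z i ^ Poly_Mapping.lookup k i)) = 0"
        if "\<And>i. i \<in> UNIV \<Longrightarrow> z i \<in> {z. Im z > 0}" for z
        using assms[of z] that by (simp add: eval_cpoly_def upper_def)
    qed (use True infinite_Im_pos in \<open>auto intro: poly_mapping_eqI\<close>)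
    then show ?thesis by simp
  qed (simp add: in_keys_iff)
qed

lemma stable_or_zero_eval_iff:
  "stable_or_zero (eval_cpoly f) \<longleftrightarrow> f \<in> stable_polys \<union> {0}"
  using eval_cpoly_eq_0_imp[of f] by (auto simp: stable_or_zero_def stable_polys_def upper_def)

text \<open>Both arguments are merged into one family over the sum type; the second half stands for
  \<open>- w\<close> and ranges over the lower half plane.\<close>

lemma symbol_eq_0_imp:
  fixes a :: "'n::finite weyl_coeffs"
  assumes "\<And>z w. z \<in> upper \<Longrightarrow> w \<in> upper \<Longrightarrow> symbol a z w = 0"
  shows "a = 0"
proof (rule poly_mapping_eqI)
  fix k
  define d :: "('n multi_index \<times> 'n multi_index) \<Rightarrow> 'n + 'n \<Rightarrow> nat" where
    "d = (\<lambda>k. case_sum (Poly_Mapping.lookup (fst k)) (Poly_Mapping.lookup (snd k)))"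
  show "Poly_Mapping.lookup a k = Poly_Mapping.lookup 0 k"
  proof (cases "k \<in> Poly_Mapping.keys a")
    case True
    have "Poly_Mapping.lookup a k = 0"
    proof (rule sum_monomials_eq_0_imp[where I = UNIV and K = "Poly_Mapping.keys a" and d = d
          and S = "case_sum (\<lambda>_. {z. Im z > 0}) (\<lambda>_. {z. Im z < 0})"])
      fix z :: "'n + 'n \<Rightarrow> complex"
      assume z: "\<And>i. i \<in> UNIV \<Longrightarrow> z i \<in> case_sum (\<lambda>_. {z. Im z > 0}) (\<lambda>_. {z. Im z < 0}) i"
      have "z \<circ> Inl \<in> upper" "(\<lambda>i. - z (Inr i)) \<in> upper"
        using z[of "Inl _"] z[of "Inr _"] by (auto simp: upper_def)
      from assms[OF this] have "(\<Sum>k\<in>Poly_Mapping.keys a. Poly_Mapping.lookup a k *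
          ((\<Prod>i\<in>UNIV. z (Inl i) ^ Poly_Mapping.lookup (fst k) i) * (\<Prod>i\<in>UNIV. z (Inr i) ^ Poly_Mapping.lookup (snd k) i))) = 0"
        by (simp add: symbol_def mval_def mult.assoc)
      moreover have "(\<Prod>i\<in>UNIV. z i ^ d k i) =
          (\<Prod>i\<in>UNIV. z (Inl i) ^ Poly_Mapping.lookup (fst k) i) * (\<Prod>i\<in>UNIV. z (Inr i) ^ Poly_Mapping.lookup (snd k) i)" for k
        unfolding UNIV_Plus_UNIV[symmetric] by (subst prod.Plus) (auto simp: d_def)
      ultimately show "(\<Sum>k\<in>Poly_Mapping.keys a. Poly_Mapping.lookup a k * (\<Prod>i\<in>UNIV. z i ^ d k i)) = 0"
        by simp
    next
      fix k l assume eq: "\<And>i. i \<in> UNIV \<Longrightarrow> d k i = d l i"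
      show "k = l"
        using eq[of "Inl _"] eq[of "Inr _"] by (auto simp: d_def prod_eq_iff intro!: poly_mapping_eqI)
    next
      show "infinite (case_sum (\<lambda>_. {z. Im z > 0}) (\<lambda>_. {z. Im z < 0}) i)" for i :: "'n + 'n"
        using infinite_Im_pos infinite_Im_neg by (cases i) auto
    qed (use True in auto)
    then show ?thesis by simp
  qed (simp add: in_keys_iff)
qed

lemma weyl_op_linear:
  "weyl_op a (Poly_Mapping.single 0 u * f + Poly_Mapping.single 0 v * g) =
    Poly_Mapping.single 0 u * weyl_op a f + Poly_Mapping.single 0 v * weyl_op a g"
proof -
  have "multi_deriv \<beta> (Poly_Mapping.single 0 u * f + Poly_Mapping.single 0 v * g) =
      Poly_Mapping.single 0 u * multi_deriv \<beta> f + Poly_Mapping.single 0 v * multi_deriv \<beta> g" for \<beta>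
    by (intro poly_mapping_eqI)
       (simp add: lookup_multi_deriv lookup_add lookup_single_0_mult distrib_left mult.left_commute)
  then show ?thesis
    by (simp add: weyl_op_def case_prod_unfold sum_distrib_left sum.distrib algebra_simps)
qed

section \<open>Conjugation of coefficients and the pencil argument\<close>

definition cnj_cpoly :: "'n::finite cpoly \<Rightarrow> 'n cpoly" where
  "cnj_cpoly f = Poly_Mapping.map cnj f"

lemma lookup_cnj_cpoly: "Poly_Mapping.lookup (cnj_cpoly f) \<alpha> = cnj (Poly_Mapping.lookup f \<alpha>)"
  by (simp add: cnj_cpoly_def map.rep_eq when_def)

lemma cnj_mval: "cnj (mval \<alpha> z) = mval \<alpha> (\<lambda>i. cnj (z i))"
  by (simp add: mval_def)

lemma eval_cnj_cpoly: "eval_cpoly (cnj_cpoly f) z = cnj (eval_cpoly f (\<lambda>i. cnj (z i)))"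
proof -
  have "Poly_Mapping.keys (cnj_cpoly f) = Poly_Mapping.keys f"
    by (auto simp: in_keys_iff lookup_cnj_cpoly)
  then show ?thesis
    by (simp add: eval_cpoly_superset[OF finite_keys order.refl] lookup_cnj_cpoly cnj_mval)
qed

lemma multi_deriv_cnj_cpoly: "multi_deriv \<beta> (cnj_cpoly f) = cnj_cpoly (multi_deriv \<beta> f)"
proof (rule poly_mapping_eqI)
  fix \<alpha>
  have "cnj (pochhammer (of_nat n + 1) m) = pochhammer (of_nat n + 1) m" for n m
    by (simp add: pochhammer_prod)
  then show "Poly_Mapping.lookup (multi_deriv \<beta> (cnj_cpoly f)) \<alpha> =
      Poly_Mapping.lookup (cnj_cpoly (multi_deriv \<beta> f)) \<alpha>"
    by (simp add: lookup_multi_deriv lookup_cnj_cpoly)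
qed

lemma eval_weyl_op_cnj_cpoly:
  assumes "\<And>k. Poly_Mapping.lookup a k \<in> \<real>"
  shows "eval_cpoly (weyl_op a (cnj_cpoly f)) z = cnj (eval_cpoly (weyl_op a f) (\<lambda>i. cnj (z i)))"
  using assms
  by (simp add: eval_weyl_op multi_deriv_cnj_cpoly eval_cnj_cpoly cnj_mval Reals_cnj_iff)

text \<open>Conjugation of coefficients commutes with a real operator and fixes \<open>f\<close>, so
  it fixes the image; the comparison is made through values, which determine a polynomial.\<close>

lemma real_coeffs_weyl_op:
  assumes a: "\<And>k. Poly_Mapping.lookup a k \<in> \<real>" and f: "\<And>\<alpha>. Poly_Mapping.lookup f \<alpha> \<in> \<real>"
  shows "Poly_Mapping.lookup (weyl_op a f) \<alpha> \<in> \<real>"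
proof -
  have "cnj_cpoly f = f"
    using f by (intro poly_mapping_eqI) (simp add: lookup_cnj_cpoly Reals_cnj_iff)
  then have "eval_cpoly (weyl_op a f) z = eval_cpoly (cnj_cpoly (weyl_op a f)) z" for z
    using eval_weyl_op_cnj_cpoly[OF a, of f z] by (simp add: eval_cnj_cpoly)
  then have "eval_cpoly (Poly_Mapping.single 0 1 * weyl_op a f + Poly_Mapping.single 0 (-1) * cnj_cpoly (weyl_op a f)) z = 0" for z
    by (simp add: eval_cpoly_add eval_cpoly_single_mult mval_def)
  then have "Poly_Mapping.single 0 1 * weyl_op a f + Poly_Mapping.single 0 (-1) * cnj_cpoly (weyl_op a f) = 0"
    by (intro eval_cpoly_eq_0_imp) auto
  then have "Poly_Mapping.lookup (Poly_Mapping.single 0 1 * weyl_op a f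
      + Poly_Mapping.single 0 (-1) * cnj_cpoly (weyl_op a f)) \<alpha> = 0"
    by (simp only: lookup_zero)
  then show ?thesis
    by (simp only: lookup_add lookup_single_0_mult lookup_cnj_cpoly) (simp add: Reals_cnj_iff)
qed

text \<open>If \<open>|F| = |G|\<close> at a point then some combination \<open>u F + cnj u G\<close> with \<open>|u| = 1\<close> vanishes there, hence
  identically, and \<open>F\<close> is a multiple of another such combination. Otherwise \<open>|F| > |G|\<close> throughout.\<close>

lemma stable_or_zero_of_pencil:
  fixes F G :: "('n \<Rightarrow> complex) \<Rightarrow> complex"
  assumes pencil: "\<And>u. cmod u = 1 \<Longrightarrow> stable_or_zero (\<lambda>z. u * F z + cnj u * G z)"
    and cont: "\<And>z0 z1. continuous_on UNIV (\<lambda>t::real. F (\<lambda>i. z0 i + of_real t * (z1 i - z0 i)))"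
      "\<And>z0 z1. continuous_on UNIV (\<lambda>t::real. G (\<lambda>i. z0 i + of_real t * (z1 i - z0 i)))"
    and z0: "z0 \<in> upper" "cmod (G z0) \<le> cmod (F z0)"
  shows "stable_or_zero F"
proof (cases "\<exists>z\<in>upper. F z = 0")
  case True
  then obtain z1 where z1: "z1 \<in> upper" "F z1 = 0" by blast
  define L where "L = (\<lambda>t::real. \<lambda>i. z0 i + of_real t * (z1 i - z0 i))"
  \<comment> \<open>The difference of the moduli is nonnegative at \<open>z0\<close> and, as
    \<open>F\<close> vanishes there, nonpositive at \<open>z1\<close>.\<close>
  have "\<exists>t\<ge>0. t \<le> 1 \<and> cmod (F (L t)) - cmod (G (L t)) = 0"
  proof (rule IVT2')
    show "continuous_on {0..1} (\<lambda>t. cmod (F (L t)) - cmod (G (L t)))"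
      unfolding L_def by (intro continuous_intros continuous_on_subset[OF cont(1)] continuous_on_subset[OF cont(2)]) auto
  qed (use z0 z1 in \<open>auto simp: L_def\<close>)
  then obtain t where t: "0 \<le> t" "t \<le> 1" "cmod (F (L t)) = cmod (G (L t))" by auto
  have L: "L t \<in> upper"
  proof (rule upperI)
    fix i
    have "Im (L t i) = (1 - t) * Im (z0 i) + t * Im (z1 i)"
      by (simp add: L_def algebra_simps)
    also have "\<dots> > 0"
      using t upperD[OF z0(1), of i] upperD[OF z1(1), of i]
      by (cases "t = 0") (auto intro: add_nonneg_pos)
    finally show "Im (L t i) > 0" .
  qed
  obtain u where u: "cmod u = 1" "u * F (L t) + cnj u * G (L t) = 0"
  proof (cases "F (L t) = 0")
    case True
    then show ?thesis using t(3) that[of 1] by simp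
  next
    case False
    \<comment> \<open>On the unit circle the wanted equation amounts to
      \<open>u\<^sup>2 * F + G = 0\<close>; equality of the moduli puts this root on the
      circle.\<close>
    define u where "u = csqrt (- (G (L t) / F (L t)))"
    have u2: "u\<^sup>2 = - (G (L t) / F (L t))" by (simp add: u_def)
    then have "(cmod u)\<^sup>2 = cmod (G (L t)) / cmod (F (L t))"
      by (metis norm_power norm_minus_cancel norm_divide)
    then have "(cmod u)\<^sup>2 = 1"
      using False by (simp flip: t(3))
    then have cu: "cmod u = 1" by (simp add: power2_eq_1_iff) (smt (verit) norm_ge_zero)
    then have uu: "cnj u * u = 1" by (metis complex_norm_square mult.commute of_real_1 one_power2)
    have "u * F (L t) + cnj u * G (L t) = cnj u * (u\<^sup>2 * F (L t) + G (L t))"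
      using uu by (simp add: power2_eq_square algebra_simps)
    also have "\<dots> = 0" using False by (simp add: u2)
    finally show ?thesis using cu that by blast
  qed
  then have zero: "u * F z + cnj u * G z = 0" if "z \<in> upper" for z
    using pencil[OF u(1)] L that unfolding stable_or_zero_def by blast
  \<comment> \<open>Multiplying \<open>u\<close> by \<open>\<i>\<close> reverses the relative sign
    of the two terms; as their sum is zero, they now add up to a multiple of
    \<open>F\<close>.\<close>
  have "stable_or_zero (\<lambda>z. (\<i> * u) * F z + cnj (\<i> * u) * G z)"
    using u(1) by (intro pencil) (simp add: norm_mult)
  moreover have eq: "(\<i> * u) * F z + cnj (\<i> * u) * G z = 2 * \<i> * u * F z" if "z \<in> upper" for z
  proof -
    have "(\<i> * u) * F z + cnj (\<i> * u) * G z = 2 * \<i> * u * F z - \<i> * (u * F z + cnj u * G z)"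
      by (simp add: algebra_simps)
    then show ?thesis using zero[OF that] by simp
  qed
  ultimately have "stable_or_zero (\<lambda>z. 2 * \<i> * u * F z)"
    unfolding stable_or_zero_def by (simp only: eq cong: ball_cong)
  moreover have "u \<noteq> 0" using u(1) by auto
  ultimately show ?thesis by (auto simp: stable_or_zero_def)
qed (auto simp: stable_or_zero_def)

text \<open>The strict inequality keeps the two terms of \<open>h\<close> from cancelling, so
  \<open>h\<close> is real stable. A real operator maps this pencil to the pencil of the image of
  \<open>f\<close>, and \<open>z0\<close> decides between the image and its reflection.\<close>

lemma weyl_op_stable_or_zero_of_real:
  fixes a :: "'n::finite weyl_coeffs"
  assumes a: "\<And>k. Poly_Mapping.lookup a k \<in> \<real>"
    and pres: "\<And>h. h \<in> real_stable_polys \<Longrightarrow> weyl_op a h \<in> stable_polys \<union> {0}"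
    and f: "\<And>z. z \<in> upper \<Longrightarrow> cmod (eval_cpoly f (\<lambda>i. cnj (z i))) < cmod (eval_cpoly f z)"
    and z0: "z0 \<in> upper"
      "cmod (eval_cpoly (weyl_op a f) (\<lambda>i. cnj (z0 i))) \<le> cmod (eval_cpoly (weyl_op a f) z0)"
  shows "stable_or_zero (eval_cpoly (weyl_op a f))"
proof (rule stable_or_zero_of_pencil[where G = "\<lambda>z. cnj (eval_cpoly (weyl_op a f) (\<lambda>i. cnj (z i)))", OF _ _ _ z0(1)])
  fix u :: complex assume u: "cmod u = 1"
  define h where "h = Poly_Mapping.single 0 u * f + Poly_Mapping.single 0 (cnj u) * cnj_cpoly f"
  have "h \<in> real_stable_polys"
    unfolding real_stable_polys_def stable_polys_def
  proof safe
    fix \<alpha> show "Poly_Mapping.lookup h \<alpha> \<in> \<real>"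
      by (simp add: h_def lookup_add lookup_single_0_mult lookup_cnj_cpoly Reals_cnj_iff)
  next
    fix z assume "\<forall>j. Im (z j) > 0" and "eval_cpoly h z = 0"
    then have "cmod (u * eval_cpoly f z) = cmod (cnj u * cnj (eval_cpoly f (\<lambda>i. cnj (z i))))"
      by (simp add: h_def eval_cpoly_add eval_cpoly_single_mult mval_def eval_cnj_cpoly)
         (metis add_eq_0_iff norm_minus_cancel norm_mult complex_mod_cnj)
    moreover have "z \<in> upper" using \<open>\<forall>j. Im (z j) > 0\<close> by (simp add: upper_def)
    ultimately show False using f[of z] u by (simp add: norm_mult)
  qed
  then have "stable_or_zero (eval_cpoly (weyl_op a h))"
    using pres by (simp add: stable_or_zero_eval_iff)
  moreover have "eval_cpoly (weyl_op a h) = (\<lambda>z. u * eval_cpoly (weyl_op a f) z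
      + cnj u * cnj (eval_cpoly (weyl_op a f) (\<lambda>i. cnj (z i))))"
    by (intro ext) (simp add: h_def weyl_op_linear eval_cpoly_add eval_cpoly_single_mult mval_def
        eval_weyl_op_cnj_cpoly[OF a])
  ultimately show "stable_or_zero (\<lambda>z. u * eval_cpoly (weyl_op a f) z
      + cnj u * cnj (eval_cpoly (weyl_op a f) (\<lambda>i. cnj (z i))))"
    by simp
next
  show "continuous_on UNIV (\<lambda>t::real. eval_cpoly (weyl_op a f) (\<lambda>i. z0 i + of_real t * (z1 i - z0 i)))" for z0 z1
    unfolding eval_cpoly_def by (intro continuous_intros)
  show "continuous_on UNIV (\<lambda>t::real. cnj (eval_cpoly (weyl_op a f) (\<lambda>i. cnj (z0 i + of_real t * (z1 i - z0 i)))))" for z0 z1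
    unfolding eval_cpoly_def by (intro continuous_intros)
qed (use z0 in simp)

section \<open>Comparison of test polynomials at a point and at its conjugate\<close>

lemma norm_one_minus_mult_cnj:
  "(cmod (1 - of_real e * w * z))\<^sup>2 = (cmod (1 - of_real e * w * cnj z))\<^sup>2 + 4 * e * (Im z * Im w)"
  unfolding cmod_power2 by (simp add: power2_eq_square algebra_simps)

text \<open>It holds in each factor: conjugating \<open>z i\<close> strictly decreases the power by
  \<open>norm_one_minus_mult_cnj\<close>, and if \<open>d i = 1\<close>, then \<open>- c i\<close>
  lies in the lower half plane and is closer to \<open>cnj (z i)\<close> than to
  \<open>z i\<close>.\<close>

lemma test_poly_cnj_less:
  fixes w c d :: "'n::finite \<Rightarrow> complex"
  assumes w: "w \<in> upper" and cd: "\<And>i. c i = 1 \<and> d i = 0 \<or> Im (c i) > 0 \<and> d i = 1"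
    and "N > 0" and z: "z \<in> upper"
  shows "cmod (eval_cpoly (test_poly N w c d) (\<lambda>i. cnj (z i))) < cmod (eval_cpoly (test_poly N w c d) z)"
proof -
  define F where "F = (\<lambda>i. cmod (1 - of_real (1 / N) * w i * cnj (z i)) ^ N * cmod (c i + d i * cnj (z i)))"
  define G where "G = (\<lambda>i. cmod (1 - of_real (1 / N) * w i * z i) ^ N * cmod (c i + d i * z i))"
  have less: "F i < G i" for i
  proof -
    have pos: "Im (z i) > 0" "Im (w i) > 0" using z w by (auto simp: upperD)
    have "(cmod (1 - of_real (1 / N) * w i * cnj (z i)))\<^sup>2 < (cmod (1 - of_real (1 / N) * w i * z i))\<^sup>2"
      unfolding norm_one_minus_mult_cnj[of _ _ "z i"] using pos \<open>N > 0\<close> by simp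
    then have "cmod (1 - of_real (1 / N) * w i * cnj (z i)) ^ N < cmod (1 - of_real (1 / N) * w i * z i) ^ N"
      using \<open>N > 0\<close> by (auto intro!: power_strict_mono dest: power_less_imp_less_base)
    moreover have "cmod (c i + d i * cnj (z i)) \<le> cmod (c i + d i * z i)"
    proof (rule power2_le_imp_le)
      show "(cmod (c i + d i * cnj (z i)))\<^sup>2 \<le> (cmod (c i + d i * z i))\<^sup>2"
        unfolding cmod_power2 using cd[of i] pos by (auto simp: power2_eq_square algebra_simps)
    qed simp
    moreover have "cmod (c i + d i * z i) > 0"
      using cd[of i] pos by (auto simp: complex_eq_iff)
    ultimately show ?thesis
      unfolding F_def G_def
      by (intro order.strict_trans1[OF mult_left_mono mult_strict_right_mono]) auto
  qed
  have nonneg: "0 \<le> F i" for i by (simp add: F_def)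
  have "prod F UNIV < prod G UNIV"
    using less nonneg by (intro prod_mono_strict[of undefined]) (auto intro: less_imp_le order.strict_trans1)
  then show ?thesis
    unfolding eval_test_poly prod_norm[symmetric] norm_mult norm_power F_def G_def .
qed

text \<open>The moduli at \<open>t\<close> and \<open>- t\<close> are asymptotically equal, so the
  ratio of their squares falls below \<open>4\<close>, chosen as a constant above \<open>1\<close>;
  \<open>t \<ge> 3 / \<kappa>\<close> gives \<open>4 \<le> 1 + \<kappa> * t\<close>.\<close>

lemma poly_reflection_growth:
  fixes P :: "complex poly"
  assumes "P \<noteq> 0" "\<kappa> > 0"
  obtains t :: real where "t > 0"
    "(cmod (poly P (of_real (- t))))\<^sup>2 < (1 + \<kappa> * t) * (cmod (poly P (of_real t)))\<^sup>2"
proof -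
  define l where "l = cmod (lead_coeff P)"
  define q where "q = (\<lambda>x. poly P x / x ^ degree P)"
  have "l > 0" using assms by (simp add: l_def)
  have q: "((\<lambda>t::real. (cmod (q (f t)))\<^sup>2) \<longlongrightarrow> l\<^sup>2) at_top" if "filterlim f at_infinity at_top" for f
    unfolding l_def q_def by (intro tendsto_intros filterlim_compose[OF poly_divide_tendsto_aux that])
  have inf: "filterlim complex_of_real at_infinity at_top"
    by (rule filterlim_of_real_at_infinity)
  then have inf': "filterlim (\<lambda>t. complex_of_real (- t)) at_infinity at_top"
    unfolding filterlim_at_infinity_conv_norm_at_top by simp
  have "((\<lambda>t. 4 * (cmod (q (of_real t)))\<^sup>2 - (cmod (q (of_real (- t))))\<^sup>2) \<longlongrightarrow> 4 * l\<^sup>2 - l\<^sup>2) at_top"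
    by (intro tendsto_intros q inf inf')
  moreover have "0 < 4 * l\<^sup>2 - l\<^sup>2" using \<open>l > 0\<close> by simp
  ultimately have "\<forall>\<^sub>F t in at_top. 0 < 4 * (cmod (q (of_real t)))\<^sup>2 - (cmod (q (of_real (- t))))\<^sup>2"
    by (rule order_tendstoD(1))
  then have "\<forall>\<^sub>F t in at_top. t > 0 \<and> t \<ge> 3 / \<kappa> \<and> (cmod (q (of_real (- t))))\<^sup>2 < 4 * (cmod (q (of_real t)))\<^sup>2"
    using eventually_gt_at_top[of "0::real"] eventually_ge_at_top[of "3 / \<kappa>"]
    by eventually_elim auto
  then obtain t :: real where t: "t > 0" "t \<ge> 3 / \<kappa>" "(cmod (q (of_real (- t))))\<^sup>2 < 4 * (cmod (q (of_real t)))\<^sup>2"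
    using eventually_happens'[OF trivial_limit_at_top_linorder] by blast
  have scale: "(cmod (poly P x))\<^sup>2 = (cmod (q x))\<^sup>2 * (cmod x ^ degree P)\<^sup>2" if "x \<noteq> 0" for x
    using that by (simp add: q_def norm_divide norm_power power_divide)
  have "(cmod (poly P (of_real (- t))))\<^sup>2 < 4 * (cmod (poly P (of_real t)))\<^sup>2"
    using t(1,3) by (simp add: scale)
  also have "\<dots> \<le> (1 + \<kappa> * t) * (cmod (poly P (of_real t)))\<^sup>2"
    using t(2) assms(2) by (intro mult_right_mono) (auto simp: field_simps)
  finally show ?thesis using that t(1) by blast
qed

lemma test_limit_line_poly:
  obtains P where "\<And>t. poly P t = test_limit a M w c d (\<lambda>i. x i + t * y i) 0"
proof
  fix t
  show "poly (\<Sum>k\<in>Poly_Mapping.keys a. smult (Poly_Mapping.lookup a k)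
      ((\<Prod>i\<in>UNIV. [:x i, y i:] ^ Poly_Mapping.lookup (fst k) i) *
       (\<Prod>i\<in>UNIV. smult ((- w i) ^ Poly_Mapping.lookup (snd k) i) [:c i + d i * x i, d i * y i:]
         + [:of_nat (Poly_Mapping.lookup (snd k) i) * d i * (- w i) ^ (Poly_Mapping.lookup (snd k) i - 1):]))) t =
    test_limit a M w c d (\<lambda>i. x i + t * y i) 0"
    unfolding test_limit_def exp_factor_limit_0 mval_def
    by (simp add: poly_sum poly_prod algebra_simps)
qed

text \<open>With the real parts of \<open>z1\<close> kept and the imaginary parts scaled by
  \<open>t\<close>, the value is a polynomial in \<open>t\<close>, conjugation of the point is
  \<open>t \<mapsto> - t\<close>, and \<open>Im (z j)\<close> grows linearly.\<close>

lemma test_limit_growth: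
  assumes w: "w \<in> upper" and z1: "z1 \<in> upper" "test_limit a M w c d z1 0 \<noteq> 0"
  obtains z where "z \<in> upper" "(cmod (test_limit a M w c d (\<lambda>i. cnj (z i)) 0))\<^sup>2 <
    (1 + 4 * (Im (z j) * Im (w j))) * (cmod (test_limit a M w c d z 0))\<^sup>2"
proof -
  define x y where "x = (\<lambda>i. complex_of_real (Re (z1 i)))" and "y = (\<lambda>i. \<i> * complex_of_real (Im (z1 i)))"
  obtain P where P: "\<And>t. poly P t = test_limit a M w c d (\<lambda>i. x i + t * y i) 0"
    using test_limit_line_poly by blast
  have "(\<lambda>i. x i + 1 * y i) = z1" by (auto simp: x_def y_def complex_eq_iff)
  then have "poly P 1 \<noteq> 0" using z1 unfolding P by simp
  then have "P \<noteq> 0" by auto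
  obtain t :: real where t: "t > 0" "(cmod (poly P (of_real (- t))))\<^sup>2 <
      (1 + 4 * (Im (z1 j) * Im (w j)) * t) * (cmod (poly P (of_real t)))\<^sup>2"
    using poly_reflection_growth[OF \<open>P \<noteq> 0\<close>, of "4 * (Im (z1 j) * Im (w j))"] upperD[OF w, of j] upperD[OF z1(1), of j]
    by auto
  define z where "z = (\<lambda>i. x i + of_real t * y i)"
  have "(\<lambda>i. cnj (z i)) = (\<lambda>i. x i + of_real (- t) * y i)"
    by (auto simp: z_def x_def y_def complex_eq_iff)
  then have "poly P (of_real (- t)) = test_limit a M w c d (\<lambda>i. cnj (z i)) 0"
    unfolding P by simp
  moreover have "poly P (of_real t) = test_limit a M w c d z 0"
    unfolding P z_def by simp
  moreover have "Im (z j) = t * Im (z1 j)" for j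
    by (simp add: z_def x_def y_def)
  ultimately show ?thesis
    using t z1(1) that[of z] by (auto simp: upper_def mult_ac)
qed

text \<open>Bernoulli's inequality bounds \<open>(A j / B j) ^ K\<close> from below; the other
  coordinates contribute a ratio of at least \<open>1\<close>.\<close>

lemma prod_ratio_bound:
  fixes A B :: "'n::finite \<Rightarrow> real"
  assumes B: "\<And>i. 0 < B i" and AB: "\<And>i. B i \<le> A i"
  shows "(1 + real K * ((A j - B j) / B j)) * (\<Prod>i\<in>UNIV. B i ^ K) \<le> (\<Prod>i\<in>UNIV. A i ^ K)"
proof -
  have "(\<Prod>i\<in>UNIV - {j}. B i ^ K) \<le> (\<Prod>i\<in>UNIV - {j}. A i ^ K)"
    using B AB by (intro prod_mono) (auto intro!: power_mono simp: less_imp_le)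
  moreover have "(1 + real K * ((A j - B j) / B j)) * B j ^ K \<le> A j ^ K"
  proof -
    have "1 + real K * ((A j - B j) / B j) \<le> (1 + (A j - B j) / B j) ^ K"
      using B[of j] AB[of j] by (intro Bernoulli_inequality) (auto intro: order.trans[of _ 0])
    also have "1 + (A j - B j) / B j = A j / B j"
      using B[of j] by (simp add: field_simps)
    finally show ?thesis
      using B[of j] by (simp add: power_divide field_simps)
  qed
  moreover have "A j ^ K \<ge> 0" "(\<Prod>i\<in>UNIV - {j}. B i ^ K) \<ge> 0"
    using B AB by (auto intro!: prod_nonneg zero_le_power intro: order.trans[OF less_imp_le] simp: less_imp_le)
  ultimately have "(1 + real K * ((A j - B j) / B j)) * B j ^ K * (\<Prod>i\<in>UNIV - {j}. B i ^ K) \<le>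
      A j ^ K * (\<Prod>i\<in>UNIV - {j}. A i ^ K)"
    by (intro mult_mono)
  then show ?thesis
    by (simp add: prod.remove[of UNIV j] mult_ac)
qed

text \<open>The products \<open>\<Prod>\<^sub>i |1 - w\<^sub>i z\<^sub>i / N|\<^sup>2\<^sup>N\<close> at \<open>z\<close> and at its conjugate differ in the limit by a factor of at
  least \<open>1 + 4 Im z\<^sub>j Im w\<^sub>j\<close>, by Bernoulli's inequality. Far from the origin this outweighs
  the remaining factor, which is asymptotically a polynomial in \<open>z\<close>; this settles which
  alternative holds in the pencil argument.\<close>

lemma test_limit_stable_or_zero_of_real:
  fixes a :: "'n::finite weyl_coeffs"
  assumes a: "\<And>k. Poly_Mapping.lookup a k \<in> \<real>"
    and pres: "\<And>h. h \<in> real_stable_polys \<Longrightarrow> weyl_op a h \<in> stable_polys \<union> {0}"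
    and M: "order_bound a M" and w: "w \<in> upper"
    and cd: "\<And>i. c i = 1 \<and> d i = 0 \<or> Im (c i) > 0 \<and> d i = 1"
  shows "stable_or_zero (\<lambda>z. test_limit a M w c d z 0)"
proof (cases "\<exists>z\<in>upper. test_limit a M w c d z 0 \<noteq> 0")
  case True
  then obtain z1 where z1: "z1 \<in> upper" "test_limit a M w c d z1 0 \<noteq> 0" by blast
  define j :: 'n where "j = undefined"
  define \<Phi> where "\<Phi> = test_limit a M w c d"
  obtain z where z: "z \<in> upper"
    "(cmod (\<Phi> (\<lambda>i. cnj (z i)) 0))\<^sup>2 < (1 + 4 * (Im (z j) * Im (w j))) * (cmod (\<Phi> z 0))\<^sup>2"
    using test_limit_growth[OF w z1, of j] by (auto simp: \<Phi>_def)
  define s where "s = 4 * (Im (z j) * Im (w j))"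
  define A where "A = (\<lambda>N i. (cmod (1 - of_real (1 / real N) * w i * z i))\<^sup>2)"
  define B where "B = (\<lambda>N i. (cmod (1 - of_real (1 / real N) * w i * cnj (z i)))\<^sup>2)"
  \<comment> \<open>The Bernoulli bound for the exponent \<open>N - M\<close>, with
    \<open>1 - M / N\<close> for \<open>(N - M) / N\<close>. It tends to \<open>1 + s\<close>
    because \<open>B N j\<close> tends to \<open>1\<close>.\<close>
  define R where "R = (\<lambda>N. 1 + (1 - real M * (1 / real N)) * (s / B N j))"
  have pos: "Im (z i) > 0" "Im (w i) > 0" for i using z(1) w by (auto simp: upperD)
  have B_lim: "(\<lambda>N. B N i) \<longlonglongrightarrow> (cmod (1 - of_real 0 * w i * cnj (z i)))\<^sup>2" for i
    unfolding B_def by (intro tendsto_intros lim_1_over_n)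
  have \<Phi>_lim: "(\<lambda>N. \<Phi> x (1 / real N)) \<longlonglongrightarrow> \<Phi> x 0" for x
    unfolding \<Phi>_def test_limit_def exp_factor_limit_def by (intro tendsto_intros lim_1_over_n)
  have "R \<longlonglongrightarrow> 1 + (1 - real M * 0) * (s / (cmod (1 - of_real 0 * w j * cnj (z j)))\<^sup>2)"
    unfolding R_def by (intro tendsto_intros lim_1_over_n B_lim) simp
  then have R_lim: "R \<longlonglongrightarrow> 1 + s" by simp
  have "(\<lambda>N. R N * (cmod (\<Phi> z (1 / N)))\<^sup>2 - (cmod (\<Phi> (\<lambda>i. cnj (z i)) (1 / N)))\<^sup>2) \<longlonglongrightarrow>
      (1 + s) * (cmod (\<Phi> z 0))\<^sup>2 - (cmod (\<Phi> (\<lambda>i. cnj (z i)) 0))\<^sup>2"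
    by (intro tendsto_intros R_lim \<Phi>_lim)
  then have ev1: "\<forall>\<^sub>F N in sequentially. R N * (cmod (\<Phi> z (1 / N)))\<^sup>2 - (cmod (\<Phi> (\<lambda>i. cnj (z i)) (1 / N)))\<^sup>2 > 0"
    by (rule order_tendstoD) (use z(2) in \<open>simp add: s_def\<close>)
  have ev2: "\<forall>\<^sub>F N in sequentially. \<forall>i. B N i > 0"
    by (intro eventually_all_finite order_tendstoD[OF B_lim]) simp
  have "\<forall>\<^sub>F N in sequentially. stable_or_zero (eval_cpoly (weyl_op a (test_poly N w c d)))"
    using ev1 ev2 eventually_gt_at_top[of 0] eventually_ge_at_top[of M]
  proof eventually_elim
    case (elim N)
    let ?T = "eval_cpoly (weyl_op a (test_poly N w c d))"
    have AB: "A N i = B N i + 4 * (1 / real N) * (Im (z i) * Im (w i))" for i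
      unfolding A_def B_def by (rule norm_one_minus_mult_cnj)
    have "(A N j - B N j) / B N j = (1 / real N) * (s / B N j)"
      by (simp add: AB s_def)
    then have "1 + real (N - M) * ((A N j - B N j) / B N j) = R N"
      using elim(3,4) unfolding R_def by (simp add: of_nat_diff field_simps)
    then have R: "R N * (\<Prod>i\<in>UNIV. B N i ^ (N - M)) \<le> (\<Prod>i\<in>UNIV. A N i ^ (N - M))"
      using prod_ratio_bound[of "B N" "A N" "N - M" j] elim(2) AB pos by (auto simp: less_imp_le)
    have Bpos: "(\<Prod>i\<in>UNIV. B N i ^ (N - M)) > 0"
      using elim(2) by (intro prod_pos) auto
    have sq: "(cmod (?T x))\<^sup>2 = (\<Prod>i\<in>UNIV. ((cmod (1 - of_real (1 / real N) * w i * x i))\<^sup>2) ^ (N - M)) *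
        (cmod (\<Phi> x (1 / N)))\<^sup>2" for x
      unfolding eval_weyl_op_test_poly[OF M elim(3,4)] norm_mult power_mult_distrib \<Phi>_def
        prod_norm[symmetric] norm_power prod_power_distrib[symmetric] power_mult[symmetric]
      by (simp only: mult.commute)
    have "(cmod (?T (\<lambda>i. cnj (z i))))\<^sup>2 = (\<Prod>i\<in>UNIV. B N i ^ (N - M)) * (cmod (\<Phi> (\<lambda>i. cnj (z i)) (1 / N)))\<^sup>2"
      unfolding sq B_def ..
    also have "\<dots> \<le> (\<Prod>i\<in>UNIV. B N i ^ (N - M)) * (R N * (cmod (\<Phi> z (1 / N)))\<^sup>2)"
      using elim(1) Bpos by (intro mult_left_mono) auto
    also have "\<dots> = (R N * (\<Prod>i\<in>UNIV. B N i ^ (N - M))) * (cmod (\<Phi> z (1 / N)))\<^sup>2"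
      by (simp only: mult_ac)
    also have "\<dots> \<le> (\<Prod>i\<in>UNIV. A N i ^ (N - M)) * (cmod (\<Phi> z (1 / N)))\<^sup>2"
      using R by (intro mult_right_mono) auto
    also have "\<dots> = (cmod (?T z))\<^sup>2"
      unfolding sq A_def ..
    finally have "cmod (?T (\<lambda>i. cnj (z i))) \<le> cmod (?T z)"
      by (rule power2_le_imp_le) simp
    then show ?case
      using test_poly_cnj_less[OF w cd \<open>N > 0\<close>] z(1)
      by (intro weyl_op_stable_or_zero_of_real[OF a pres]) auto
  qed
  then show ?thesis
    by (rule test_limit_stable_or_zero[OF M w])
next
  case False
  then show ?thesis unfolding stable_or_zero_def by blast
qed

section \<open>Preservers characterised by their symbol, and duality\<close>

definition stable_symbol :: "'n::finite weyl_coeffs \<Rightarrow> bool" where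
  "stable_symbol a \<longleftrightarrow> (\<forall>z\<in>upper. \<forall>w\<in>upper. symbol a z w \<noteq> 0)"

lemma weyl_op_eq_0_iff: "weyl_op a = (\<lambda>_. 0) \<longleftrightarrow> a = 0"
proof
  have zero: "weyl_op 0 = (\<lambda>_. 0 :: 'a cpoly)"
    by (intro ext) (simp add: weyl_op_def)
  show "weyl_op a = (\<lambda>_. 0)" if "a = 0" using that zero by simp
  assume "weyl_op a = (\<lambda>_. 0)"
  with zero have "weyl_op a = weyl_op 0" by simp
  then show "a = 0" by (rule injD[OF inj_weyl_op])
qed

lemma stable_symbol_imp_nz: "a \<noteq> 0" if "stable_symbol a"
proof
  assume "a = 0"
  then have "symbol a (\<lambda>_. \<i>) (\<lambda>_. \<i>) = 0" by (simp add: symbol_def)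
  then show False using that by (auto simp: stable_symbol_def upper_def)
qed

lemma stable_symbol_preserves:
  assumes "stable_symbol a" "f \<in> stable_polys"
  shows "weyl_op a f \<in> stable_polys \<union> {0}"
  unfolding stable_or_zero_eval_iff[symmetric] stable_or_zero_def
  using assms by (intro weyl_op_stable_or_zero) (auto simp: stable_symbol_def stable_polys_def upper_def)

text \<open>A nonzero \<open>a\<close> has a symbol that is nonzero at some pair of points of
  \<open>upper\<close>; the test polynomials spread this to all pairs.\<close>

lemma stable_symbolI:
  fixes a :: "'n::finite weyl_coeffs"
  assumes "a \<noteq> 0"
    and "\<And>M w c d. order_bound a M \<Longrightarrow> w \<in> upper \<Longrightarrow> (\<And>i. c i = 1 \<and> d i = 0 \<or> Im (c i) > 0 \<and> d i = 1) \<Longrightarrow>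
      stable_or_zero (\<lambda>z. test_limit a M w c d z 0)"
  shows "stable_symbol a"
proof -
  obtain M where M: "order_bound a M" using ex_order_bound by blast
  obtain z1 w1 where "z1 \<in> upper" "w1 \<in> upper" "symbol a z1 w1 \<noteq> 0"
    using symbol_eq_0_imp assms(1) by blast
  note test = symbol_nz_of_test_polys[OF assms(2)[OF M] this]
  show ?thesis
    unfolding stable_symbol_def by (intro ballI test)
qed

lemma stability_preservers_iff: "weyl_op a \<in> stability_preservers \<longleftrightarrow> stable_symbol a"
proof
  assume a: "weyl_op a \<in> stability_preservers"
  show "stable_symbol a"
  proof (rule stable_symbolI)
    show "a \<noteq> 0" using a by (simp add: stability_preservers_def weyl_op_eq_0_iff)
    fix M and w c d :: "'a \<Rightarrow> complex"
    assume M: "order_bound a M" and w: "w \<in> upper"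
      and cd: "\<And>i. c i = 1 \<and> d i = 0 \<or> Im (c i) > 0 \<and> d i = 1"
    have "test_poly N w c d \<in> stable_polys" for N
    proof -
      have "c i + d i * x \<noteq> 0" if "Im x > 0" for i x
        using cd[of i] that by (auto simp: complex_eq_iff)
      then show ?thesis
        using test_poly_nz[OF w] by (auto simp: stable_polys_def upper_def)
    qed
    then have "stable_or_zero (eval_cpoly (weyl_op a (test_poly N w c d)))" for N
      using a unfolding stable_or_zero_eval_iff stability_preservers_def by blast
    then show "stable_or_zero (\<lambda>z. test_limit a M w c d z 0)"
      by (intro test_limit_stable_or_zero[OF M w] always_eventually) simp
  qed
next
  assume "stable_symbol a"
  then show "weyl_op a \<in> stability_preservers"
    using stable_symbol_preserves stable_symbol_imp_nz
    by (fastforce simp: stability_preservers_def weyl_algebra_def weyl_op_eq_0_iff)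
qed

lemma real_stability_preservers_iff:
  assumes a: "\<And>k. Poly_Mapping.lookup a k \<in> \<real>"
  shows "weyl_op a \<in> real_stability_preservers \<longleftrightarrow> stable_symbol a"
proof
  assume pres: "weyl_op a \<in> real_stability_preservers"
  show "stable_symbol a"
  proof (rule stable_symbolI)
    show "a \<noteq> 0" using pres by (simp add: real_stability_preservers_def weyl_op_eq_0_iff)
    have "weyl_op a h \<in> stable_polys \<union> {0}" if "h \<in> real_stable_polys" for h
      using pres that by (auto simp: real_stability_preservers_def real_stable_polys_def)
    then show "stable_or_zero (\<lambda>z. test_limit a M w c d z 0)"
      if "order_bound a M" "w \<in> upper" "\<And>i. c i = 1 \<and> d i = 0 \<or> Im (c i) > 0 \<and> d i = 1" for M w c d
      using that by (intro test_limit_stable_or_zero_of_real[OF a])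
  qed
next
  assume sym: "stable_symbol a"
  have "weyl_op a f \<in> real_stable_polys \<union> {0}" if "f \<in> real_stable_polys" for f
    using stable_symbol_preserves[OF sym, of f] real_coeffs_weyl_op[OF a, of f] that
    by (auto simp: real_stable_polys_def)
  then show "weyl_op a \<in> real_stability_preservers"
    using a stable_symbol_imp_nz[OF sym]
    by (auto simp: real_stability_preservers_def real_weyl_algebra_def weyl_op_eq_0_iff)
qed

lemma symbol_dual_coeffs:
  "symbol (dual_coeffs a) z w = cnj (symbol a (\<lambda>i. - cnj (w i)) (\<lambda>i. - cnj (z i)))"
proof -
  have "Poly_Mapping.keys (dual_coeffs a) = prod.swap ` Poly_Mapping.keys a"
    by (force simp: in_keys_iff lookup_dual_coeffs image_iff)
  then have "symbol (dual_coeffs a) z w = (\<Sum>k\<in>Poly_Mapping.keys a.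
      Poly_Mapping.lookup (dual_coeffs a) (prod.swap k) * mval (snd k) z * mval (fst k) (\<lambda>i. - w i))"
    by (simp add: symbol_def sum.reindex inj_swap)
  also have "\<dots> = cnj (symbol a (\<lambda>i. - cnj (w i)) (\<lambda>i. - cnj (z i)))"
    by (simp add: symbol_def prod.swap_def lookup_dual_coeffs cnj_mval mult_ac)
  finally show ?thesis .
qed

text \<open>The map \<open>z \<mapsto> - cnj z\<close> keeps imaginary parts, so
  \<open>upper\<close> is mapped to itself; the converse follows because dualising twice gives back
  \<open>a\<close>.\<close>

lemma stable_symbol_dual_coeffs: "stable_symbol (dual_coeffs a) \<longleftrightarrow> stable_symbol a"
proof -
  have "stable_symbol (dual_coeffs b)" if "stable_symbol b" for b :: "'a weyl_coeffs"
    using that by (auto simp: stable_symbol_def symbol_dual_coeffs upper_def)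
  moreover have "dual_coeffs (dual_coeffs a) = a"
    by (intro poly_mapping_eqI) (auto simp: lookup_dual_coeffs)
  ultimately show ?thesis by metis
qed

theorem theorem1p11:
  fixes T :: "'n::finite cpoly \<Rightarrow> 'n cpoly"
  shows "(T \<in> weyl_algebra \<longrightarrow>
            (T \<in> stability_preservers \<longleftrightarrow> fischer_fock_dual T \<in> stability_preservers)) \<and>
         (T \<in> real_weyl_algebra \<longrightarrow>
            (T \<in> real_stability_preservers \<longleftrightarrow> fischer_fock_dual T \<in> real_stability_preservers))"
proof (intro conjI impI)
  assume "T \<in> weyl_algebra"
  then show "T \<in> stability_preservers \<longleftrightarrow> fischer_fock_dual T \<in> stability_preservers"
    by (auto simp: weyl_algebra_def fischer_fock_dual_weyl_op stability_preservers_iff stable_symbol_dual_coeffs)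
next
  assume "T \<in> real_weyl_algebra"
  then obtain a where T: "T = weyl_op a" and a: "\<And>k. Poly_Mapping.lookup a k \<in> \<real>"
    by (auto simp: real_weyl_algebra_def)
  have "Poly_Mapping.lookup (dual_coeffs a) k \<in> \<real>" for k
    using a Reals_cnj_iff by (cases k) (metis lookup_dual_coeffs)
  then show "T \<in> real_stability_preservers \<longleftrightarrow> fischer_fock_dual T \<in> real_stability_preservers"
    using a by (simp add: T fischer_fock_dual_weyl_op real_stability_preservers_iff stable_symbol_dual_coeffs)
qed

end
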